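(* Let $\mathcal{T}_n^d$ be the trace ring of $d$-tuples of generic $n\times n$ matrices. Then any double Poisson bracket on $\mathbb{C}\langle x_1,\dots,x_d\rangle$ turns $\mathcal{T}_n^d$ into a Poisson order over its center.
   Context: All associative algebras are unital over $\mathbb{C}$; $\otimes=\otimes_{\mathbb{C}}$. Let $A=\mathbb{C}\langle x_1,\dots,x_d\rangle$. Let $X_i=(x_{i,kl})$, $1\le i\le d$, be generic $n\times n$ matrices over the polynomial ring $\mathbb{C}[x_{i,kl}]$; the trace ring $\mathcal{T}_n^d\subset M_n(\mathbb{C}[x_{i,kl}])$ is the subalgebra generated by the $X_i$ and by the traces $tr(w(X_1,\dots,X_d))$ of all words $w$ (as scalar matrices). Its center is the algebra $\mathbb{C}[\mathrm{iss}_n(A)]=\mathbb{C}[x_{i,kl}]^{\mathrm{GL}_n(\mathbb{C})}$ generated by these traces. A double Poisson bracket on $A$ is a linear map $\{\!\{-,-\}\!\}:A\otimes A\to A\otimes A$ with: (1) $\{\!\{a,b\}\!\}=-\{\!\{b,a\}\!\}^o$, where $(u\otimes v)^o=v\otimes u$; (2) $\{\!\{a,bc\}\!\}=b.\{\!\{a,c\}\!\}+\{\!\{a,b\}\!\}.c$ for the outer action $a.(u\otimes v).c=(au)\otimes(vc)$; (3) writing $\{\!\{a,b\}\!\}=\{\!\{a,b\}\!\}'\otimes\{\!\{a,b\}\!\}''$ (summation suppressed) and $\sigma(a_1\otimes a_2\otimes a_3)=a_3\otimes a_1\otimes a_2$, $$\{\!\{a,\{\!\{b,c\}\!\}'\}\!\}\otimes\{\!\{b,c\}\!\}''+\sigma\big(\{\!\{b,\{\!\{c,a\}\!\}'\}\!\}\otimes\{\!\{c,a\}\!\}''\big)+\sigma^{-1}\big(\{\!\{c,\{\!\{a,b\}\!\}'\}\!\}\otimes\{\!\{a,b\}\!\}''\big)=0.$$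 Put $\{a,b\}_L=\mu(\{\!\{a,b\}\!\})$ with $\mu$ the multiplication; it depends on $a$ only modulo the span $[A,A]$ of commutators and induces a Lie bracket $\{-,-\}$ on $A/[A,A]$. Poisson order: a triple $(B,Z,H)$ with $B$ an algebra, $Z$ a central subalgebra, $H:Z\to\mathrm{Der}_{\mathbb{C}}(B)$ a linear map satisfying the Leibniz identity $H(zz')=zH(z')+z'H(z)$, such that $B$ is finitely generated as a $Z$-module and $\{z,z'\}:=H(z)(z')$ defines a Poisson structure on $Z$. The map $H$ by which a double Poisson bracket turns $\mathcal{T}_n^d$ into a Poisson order over its center is the one induced by the bracket: $H(tr(w))(tr(w'))=tr(\{w,w'\})$ for words $w,w'$, and $H(tr(w))(a(X_1,\dots,X_d))=\{w,a\}_L(X_1,\dots,X_d)$ for $a\in A$, extended by the Leibniz rules. *)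

theory Defs
  imports
    "HOL-Analysis.Analysis"
    "HOL-Library.Poly_Mapping"
    "HOL-Library.Product_Plus"
    "HOL-Algebra.Algebraic_Closure_Type"
begin

section \<open>Free algebras and their tensor powers\<close>

text \<open>
  Words in the letters \<open>'d\<close> are lists, a monoid (written additively) under concatenation. Hence the
  convolution product of \<open>Poly_Mapping\<close> makes \<open>'d list \<Rightarrow>\<^sub>0 complex\<close> the free algebra on
  \<open>CARD('d)\<close> generators. Tensor powers are represented in the basis of tuples of words; on
  \<open>'d list \<times> 'd list \<Rightarrow>\<^sub>0 complex\<close> the convolution product is the product of the tensor
  product algebra, \<open>(u \<otimes> v) (u' \<otimes> v') = u u' \<otimes> v v'\<close>.
\<close>

instantiation list :: (type) monoid_add
begin

definition zero_list :: "'a list" where "zero_list = []"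

definition plus_list :: "'a list \<Rightarrow> 'a list \<Rightarrow> 'a list" where "plus_list = (@)"

instance by standard (simp_all add: zero_list_def plus_list_def)

end

type_synonym 'd free_alg = "'d list \<Rightarrow>\<^sub>0 complex"
type_synonym 'd free_alg2 = "('d list \<times> 'd list) \<Rightarrow>\<^sub>0 complex"
type_synonym 'd free_alg3 = "(('d list \<times> 'd list) \<times> 'd list) \<Rightarrow>\<^sub>0 complex"

definition cscale :: "complex \<Rightarrow> ('k \<Rightarrow>\<^sub>0 complex) \<Rightarrow> ('k \<Rightarrow>\<^sub>0 complex)"
  where "cscale c p = Poly_Mapping.map ((*) c) p"

definition lin_extend :: "('k \<Rightarrow> ('l \<Rightarrow>\<^sub>0 complex)) \<Rightarrow> ('k \<Rightarrow>\<^sub>0 complex) \<Rightarrow> ('l \<Rightarrow>\<^sub>0 complex)"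
  where "lin_extend f p = (\<Sum>k\<in>Poly_Mapping.keys p. cscale (Poly_Mapping.lookup p k) (f k))"

definition basis :: "'k \<Rightarrow> ('k \<Rightarrow>\<^sub>0 complex)"
  where "basis k = Poly_Mapping.single k 1"

definition tensor :: "('k \<Rightarrow>\<^sub>0 complex) \<Rightarrow> ('l \<Rightarrow>\<^sub>0 complex) \<Rightarrow> ('k \<times> 'l \<Rightarrow>\<^sub>0 complex)"
  where "tensor p q = lin_extend (\<lambda>u. lin_extend (\<lambda>v. basis (u, v)) q) p"

definition opposite :: "'d free_alg2 \<Rightarrow> 'd free_alg2"
  where "opposite = lin_extend (\<lambda>(u, v). basis (v, u))"

definition mu :: "'d free_alg2 \<Rightarrow> 'd free_alg"
  where "mu = lin_extend (\<lambda>(u, v). basis (u @ v))"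

definition sigma :: "'d free_alg3 \<Rightarrow> 'd free_alg3"
  where "sigma = lin_extend (\<lambda>((u, v), w). basis ((w, u), v))"

definition sigma_inv :: "'d free_alg3 \<Rightarrow> 'd free_alg3"
  where "sigma_inv = lin_extend (\<lambda>((u, v), w). basis ((v, w), u))"

text \<open>The outer bimodule action \<open>a.(u \<otimes> v).c = (a u) \<otimes> (v c)\<close>.\<close>

definition outer :: "'d free_alg \<Rightarrow> 'd free_alg2 \<Rightarrow> 'd free_alg \<Rightarrow> 'd free_alg2"
  where "outer a t c = tensor a 1 * t * tensor 1 c"


section \<open>Double Poisson brackets\<close>

text \<open>The linear map \<open>u \<otimes> v \<mapsto> D (a \<otimes> u) \<otimes> v\<close>.\<close>

definition bracket_left :: "('d free_alg2 \<Rightarrow> 'd free_alg2) \<Rightarrow> 'd free_alg \<Rightarrow> 'd free_alg2 \<Rightarrow> 'd free_alg3"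
  where "bracket_left D a = lin_extend (\<lambda>(u, v). tensor (D (tensor a (basis u))) (basis v))"

definition double_poisson_bracket :: "('d free_alg2 \<Rightarrow> 'd free_alg2) \<Rightarrow> bool"
  where "double_poisson_bracket D \<longleftrightarrow>
    Vector_Spaces.linear cscale cscale D \<and>
    (\<forall>a b. D (tensor a b) = - opposite (D (tensor b a))) \<and>
    (\<forall>a b c. D (tensor a (b * c)) = outer b (D (tensor a c)) 1 + outer 1 (D (tensor a b)) c) \<and>
    (\<forall>a b c. bracket_left D a (D (tensor b c))
           + sigma (bracket_left D b (D (tensor c a)))
           + sigma_inv (bracket_left D c (D (tensor a b))) = 0)"

definition bracket_L :: "('d free_alg2 \<Rightarrow> 'd free_alg2) \<Rightarrow> 'd free_alg \<Rightarrow> 'd free_alg \<Rightarrow> 'd free_alg"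
  where "bracket_L D a b = mu (D (tensor a b))"


section \<open>Poisson orders\<close>

definition complex_algebra :: "(complex, 'b) module \<Rightarrow> bool"
  where "complex_algebra B \<longleftrightarrow>
    ring B \<and> module (ring_of_type_algebra :: complex ring) B \<and>
    (\<forall>c. \<forall>x\<in>carrier B. \<forall>y\<in>carrier B.
      (c \<odot>\<^bsub>B\<^esub> x) \<otimes>\<^bsub>B\<^esub> y = c \<odot>\<^bsub>B\<^esub> (x \<otimes>\<^bsub>B\<^esub> y) \<and>
      x \<otimes>\<^bsub>B\<^esub> (c \<odot>\<^bsub>B\<^esub> y) = c \<odot>\<^bsub>B\<^esub> (x \<otimes>\<^bsub>B\<^esub> y))"

definition complex_subalgebra :: "'b set \<Rightarrow> (complex, 'b) module \<Rightarrow> bool"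
  where "complex_subalgebra S B \<longleftrightarrow> subring S B \<and> (\<forall>c. \<forall>x\<in>S. c \<odot>\<^bsub>B\<^esub> x \<in> S)"

definition generated_subalgebra :: "(complex, 'b) module \<Rightarrow> 'b set \<Rightarrow> 'b set"
  where "generated_subalgebra B G = (\<lambda>S. complex_subalgebra S B) hull G"

definition algebra_center :: "(complex, 'b) module \<Rightarrow> 'b set"
  where "algebra_center B = {z \<in> carrier B. \<forall>b\<in>carrier B. z \<otimes>\<^bsub>B\<^esub> b = b \<otimes>\<^bsub>B\<^esub> z}"

definition derivation :: "(complex, 'b) module \<Rightarrow> ('b \<Rightarrow> 'b) \<Rightarrow> bool"
  where "derivation B \<delta> \<longleftrightarrow>
    \<delta> \<in> carrier B \<rightarrow> carrier B \<and>
    (\<forall>x\<in>carrier B. \<forall>y\<in>carrier B. \<delta> (x \<oplus>\<^bsub>B\<^esub> y) = \<delta> x \<oplus>\<^bsub>B\<^esub> \<delta> y) \<and>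
    (\<forall>c. \<forall>x\<in>carrier B. \<delta> (c \<odot>\<^bsub>B\<^esub> x) = c \<odot>\<^bsub>B\<^esub> \<delta> x) \<and>
    (\<forall>x\<in>carrier B. \<forall>y\<in>carrier B.
      \<delta> (x \<otimes>\<^bsub>B\<^esub> y) = x \<otimes>\<^bsub>B\<^esub> \<delta> y \<oplus>\<^bsub>B\<^esub> \<delta> x \<otimes>\<^bsub>B\<^esub> y)"

text \<open>Linearity in the first argument is a consequence of antisymmetry.\<close>

definition poisson_structure :: "(complex, 'b) module \<Rightarrow> ('b \<Rightarrow> 'b \<Rightarrow> 'b) \<Rightarrow> bool"
  where "poisson_structure P br \<longleftrightarrow>
    complex_algebra P \<and> cring P \<and>
    (\<forall>x\<in>carrier P. derivation P (br x)) \<and>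
    (\<forall>x\<in>carrier P. \<forall>y\<in>carrier P. br x y = \<ominus>\<^bsub>P\<^esub> br y x) \<and>
    (\<forall>x\<in>carrier P. \<forall>y\<in>carrier P. \<forall>z\<in>carrier P.
      br x (br y z) \<oplus>\<^bsub>P\<^esub> br y (br z x) \<oplus>\<^bsub>P\<^esub> br z (br x y) = \<zero>\<^bsub>P\<^esub>)"

definition finitely_generated_over :: "(complex, 'b) module \<Rightarrow> 'b set \<Rightarrow> bool"
  where "finitely_generated_over B Z \<longleftrightarrow>
    (\<exists>S. finite S \<and> S \<subseteq> carrier B \<and>
      (\<forall>b\<in>carrier B. \<exists>c \<in> S \<rightarrow> Z. b = (\<Oplus>\<^bsub>B\<^esub>s\<in>S. c s \<otimes>\<^bsub>B\<^esub> s)))"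

text \<open>Only the values of \<open>H\<close> at \<open>Z\<close> and \<open>carrier B\<close> matter.\<close>

definition poisson_order :: "(complex, 'b) module \<Rightarrow> 'b set \<Rightarrow> ('b \<Rightarrow> 'b \<Rightarrow> 'b) \<Rightarrow> bool"
  where "poisson_order B Z H \<longleftrightarrow>
    complex_algebra B \<and>
    complex_subalgebra Z B \<and> Z \<subseteq> algebra_center B \<and>
    (\<forall>z\<in>Z. derivation B (H z)) \<and>
    (\<forall>z\<in>Z. \<forall>z'\<in>Z. \<forall>b\<in>carrier B. H (z \<oplus>\<^bsub>B\<^esub> z') b = H z b \<oplus>\<^bsub>B\<^esub> H z' b) \<and>
    (\<forall>c. \<forall>z\<in>Z. \<forall>b\<in>carrier B. H (c \<odot>\<^bsub>B\<^esub> z) b = c \<odot>\<^bsub>B\<^esub> H z b) \<and>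
    (\<forall>z\<in>Z. \<forall>z'\<in>Z. \<forall>b\<in>carrier B.
      H (z \<otimes>\<^bsub>B\<^esub> z') b = z \<otimes>\<^bsub>B\<^esub> H z' b \<oplus>\<^bsub>B\<^esub> z' \<otimes>\<^bsub>B\<^esub> H z b) \<and>
    finitely_generated_over B Z \<and>
    poisson_structure (B\<lparr>carrier := Z\<rparr>) H"


section \<open>Generic matrices and the trace ring\<close>

text \<open>
  The polynomial ring in the commuting variables \<open>x\<^bsub>i,kl\<^esub>\<close>: exponents are finitely supported
  functions on the triples \<open>(i, k, l)\<close>.
\<close>

type_synonym ('d, 'n) coord_ring = "(('d \<times> 'n \<times> 'n) \<Rightarrow>\<^sub>0 nat) \<Rightarrow>\<^sub>0 complex"
type_synonym ('d, 'n) gmatrix = "('d, 'n) coord_ring^'n^'n"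

definition gmatrix_scale :: "complex \<Rightarrow> ('d, 'n::finite) gmatrix \<Rightarrow> ('d, 'n) gmatrix"
  where "gmatrix_scale c M = (\<chi> k l. cscale c (M $ k $ l))"

definition gmatrix_algebra :: "(complex, ('d, 'n::finite) gmatrix) module"
  where "gmatrix_algebra =
    \<lparr>carrier = UNIV, monoid.mult = (**), one = mat 1, zero = 0, add = (+), smult = gmatrix_scale\<rparr>"

definition generic_matrix :: "'d \<Rightarrow> ('d, 'n::finite) gmatrix"
  where "generic_matrix i =
    (\<chi> k l. Poly_Mapping.single (Poly_Mapping.single (i, k, l) 1) 1)"

primrec word_matrix :: "'d list \<Rightarrow> ('d, 'n::finite) gmatrix" where
  "word_matrix [] = mat 1"
| "word_matrix (i # w) = generic_matrix i ** word_matrix w"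

text \<open>The value \<open>a(X\<^sub>1, \<dots>, X\<^sub>d)\<close> of a noncommutative polynomial at the generic matrices.\<close>

definition eval_generic :: "'d free_alg \<Rightarrow> ('d, 'n::finite) gmatrix"
  where "eval_generic a =
    (\<Sum>w\<in>Poly_Mapping.keys a. gmatrix_scale (Poly_Mapping.lookup a w) (word_matrix w))"

text \<open>Traces are regarded as scalar matrices.\<close>

definition tr :: "'d free_alg \<Rightarrow> ('d, 'n::finite) gmatrix"
  where "tr a = mat (trace (eval_generic a))"

definition trace_algebra :: "('d, 'n::finite) gmatrix set"
  where "trace_algebra = generated_subalgebra gmatrix_algebra (range (\<lambda>w. tr (basis w)))"

definition trace_ring :: "(complex, ('d, 'n::finite) gmatrix) module"
  where "trace_ring = gmatrix_algebra\<lparr>carrier :=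
    generated_subalgebra gmatrix_algebra (range generic_matrix \<union> range (\<lambda>w. tr (basis w)))\<rparr>"

end

(*
  Van den Bergh: the formula {a_kl, b_uv} = D(a,b)'_ul D(a,b)''_kv defines an antisymmetric biderivation of the
  polynomial ring C[x_i,kl]. Bracketing entrywise with tr w sends a(X) to {w,a}_L(X), hence preserves the trace
  ring and its subalgebra of traces. On traces the Jacobi identity is the image of the double Jacobi identity
  under the cyclically invariant map u (x) v (x) w |-> tr(uvw).

  Finite generation: the Faddeev-LeVerrier recursion, obtained from the vanishing of antisymmetrized trace
  products of more than n factors, puts a(X)^n into the ideal Z_+ T generated by traces of positive degree if a
  has no constant term. By Nagata-Higman every word of length 2^n - 1 lies in Z_+ T, and a graded Nakayama
  argument shows that shorter words generate T over the traces.

  For d >= 2 an element of T commuting with two generic matrices is scalar, and since T is closed under the trace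
  it lies in the algebra of traces. For d = 1 the center is larger, but then {-,-}_L = 0 and H = 0 works.
*)
theory Submission
  imports Defs
begin

no_notation fps_nth (infixl "$" 75)

section \<open>The Nagata--Higman theorem\<close>

text \<open>Several obstacles shape the proof. The coefficients in Cayley-Hamilton must be visible
  as polynomials in traces, which a determinant hides; antisymmetrizing produces them as traces from
  the start. The identity controls powers of a single element only, whereas generation needs
  products of different letters; polarization closes this gap, at the price of dividing by integers
  and of a length that grows from N to 2 N + 1 at each step, whence 2^n - 1. The quotient T / Z_+ T
  is never formed: Nagata-Higman is stated relative to an ideal \<open>J\<close>, later the preimage
  of Z_+ T in the free algebra, so that one type carries the whole induction. Finally,
  \<open>H\<close> is a function on matrices. Bracketing entrywise with one polynomial makes sense
  for scalar matrices only, and for d = 1 and n >= 2 the center contains the generic matrix itself,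
  which is not scalar; hence the separate treatment of one generator.\<close>

definition ideal_of_ring :: "'a::ring_1 set \<Rightarrow> bool"
  where "ideal_of_ring J \<longleftrightarrow> 0 \<in> J \<and> (\<forall>x\<in>J. \<forall>y\<in>J. x + y \<in> J) \<and> (\<forall>x\<in>J. \<forall>u. u * x \<in> J \<and> x * u \<in> J)"

lemma ideal_of_ringD:
  assumes "ideal_of_ring J"
  shows ideal_zero: "0 \<in> J"
    and ideal_add: "x \<in> J \<Longrightarrow> y \<in> J \<Longrightarrow> x + y \<in> J"
    and ideal_lmult: "x \<in> J \<Longrightarrow> u * x \<in> J"
    and ideal_rmult: "x \<in> J \<Longrightarrow> x * u \<in> J"
  using assms by (auto simp: ideal_of_ring_def)

lemma ideal_minus:
  assumes "ideal_of_ring J" "x \<in> J" "y \<in> J"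
  shows "x - y \<in> J"
  using ideal_add[OF assms(1,2) ideal_lmult[OF assms(1,3), of "-1"]] by simp

lemma ideal_sum:
  assumes "ideal_of_ring J" "\<And>i. i \<in> A \<Longrightarrow> f i \<in> J"
  shows "sum f A \<in> J"
  using assms(2) by (induction A rule: infinite_finite_induct)
    (auto intro: ideal_add[OF assms(1)] ideal_zero[OF assms(1)])

text \<open>Characteristic 0 enters the ring-theoretic part as \<open>inv\<close>: positive integers
  have left inverses. The sign of \<open>m\<close> is removed by multiplying with -1.\<close>

lemma ideal_cancel_int:
  fixes J :: "'a::ring_1 set"
  assumes "ideal_of_ring J" and inv: "\<And>k. k > 0 \<Longrightarrow> \<exists>r::'a. r * of_nat k = 1"
    and "m \<noteq> 0" "of_int m * x \<in> J"
  shows "x \<in> J"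
proof -
  have "of_nat (nat \<bar>m\<bar>) * x \<in> J"
    using assms(4) ideal_lmult[OF assms(1,4), of "-1"] by (cases "m \<ge> 0") auto
  moreover have "nat \<bar>m\<bar> > 0" using \<open>m \<noteq> 0\<close> by simp
  then obtain r :: 'a where r: "r * of_nat (nat \<bar>m\<bar>) = 1" using inv by blast
  ultimately have "r * (of_nat (nat \<bar>m\<bar>) * x) \<in> J" by (blast intro: ideal_lmult[OF assms(1)])
  then show ?thesis by (simp only: mult.assoc[symmetric] r mult_1)
qed

text \<open>The substitution \<open>t \<mapsto> 2 t\<close> eliminates the leading coefficient, which replaces the Vandermonde determinant.\<close>

lemma ideal_coefficients:
  fixes J :: "'a::ring_1 set"
  assumes J: "ideal_of_ring J" and inv: "\<And>k. k > 0 \<Longrightarrow> \<exists>r::'a. r * of_nat k = 1"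
    and "\<And>t::nat. (\<Sum>k\<le>n. of_nat (t ^ k) * h k) \<in> J" "k \<le> n"
  shows "h k \<in> J"
  using assms(3,4)
proof (induction n arbitrary: h k)
  case 0
  then show ?case using 0(1)[of 1] by simp
next
  case (Suc n)
  have low: "h k \<in> J" if "k \<le> n" for k
  proof -
    have "(\<Sum>k\<le>n. of_nat (t ^ k) * (of_int (2 ^ k - 2 ^ Suc n) * h k)) \<in> J" for t :: nat
    proof -
      have "(\<Sum>k\<le>n. of_nat (t ^ k) * (of_int (2 ^ k - 2 ^ Suc n) * h k)) =
        (\<Sum>k\<le>Suc n. of_nat (t ^ k) * (of_int (2 ^ k - 2 ^ Suc n) * h k))" by simp
      also have "\<dots> = (\<Sum>k\<le>Suc n. of_nat ((2 * t) ^ k) * h k) -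
          of_nat (2 ^ Suc n) * (\<Sum>k\<le>Suc n. of_nat (t ^ k) * h k)"
        unfolding sum_distrib_left sum_subtractf[symmetric]
      proof (rule sum.cong)
        fix k
        have "of_nat (t ^ k) * of_int (2 ^ k - 2 ^ Suc n) =
          (of_nat ((2 * t) ^ k) - of_nat (2 ^ Suc n) * of_nat (t ^ k) :: 'a)"
        proof -
          have "int (t ^ k) * (2 ^ k - 2 ^ Suc n) = int ((2 * t) ^ k) - int (2 ^ Suc n) * int (t ^ k)"
            by (simp add: algebra_simps power_mult_distrib)
          from arg_cong[OF this, of "of_int :: int \<Rightarrow> 'a"] show ?thesis
            by (simp only: of_int_mult of_int_diff of_int_of_nat_eq)
        qed
        then show "of_nat (t ^ k) * (of_int (2 ^ k - 2 ^ Suc n) * h k) =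
          of_nat ((2 * t) ^ k) * h k - of_nat (2 ^ Suc n) * (of_nat (t ^ k) * h k)"
          by (metis (no_types, lifting) left_diff_distrib mult.assoc)
      qed simp
      also have "\<dots> \<in> J" by (intro ideal_minus[OF J] ideal_lmult[OF J] Suc.prems)
      finally show ?thesis .
    qed
    from Suc.IH[OF this that] have "of_int (2 ^ k - 2 ^ Suc n) * h k \<in> J" .
    moreover have "(2::int) ^ k < 2 ^ Suc n" using that by (intro power_strict_increasing) auto
    then have "(2::int) ^ k - 2 ^ Suc n \<noteq> 0" by simp
    ultimately show ?thesis using ideal_cancel_int[OF J inv] by blast
  qed
  \<comment> \<open>At t = 1 the polynomial is the plain sum of its coefficients, so the last one
    follows from the others.\<close>
  have "(\<Sum>k\<le>Suc n. h k) - (\<Sum>k\<le>n. h k) \<in> J"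
  proof (rule ideal_minus[OF J])
    show "(\<Sum>k\<le>Suc n. h k) \<in> J" using Suc.prems(1)[of 1] by simp
    show "(\<Sum>k\<le>n. h k) \<in> J" by (rule ideal_sum[OF J low]) simp
  qed
  then have "h (Suc n) \<in> J" by simp
  with low Suc.prems(2) show ?case by (cases "k = Suc n") auto
qed

text \<open>Natural numbers are central, so the witness \<open>h k\<close> is the sum of all words
  with \<open>k\<close> letters \<open>y\<close> and \<open>n - k\<close> letters \<open>x\<close>.
  The goal is \<open>h 1\<close>, the polarization of the n-th power; vanishing beyond
  \<open>n\<close> lets the sums be extended by one term in the induction.\<close>

lemma power_expansion:
  fixes x y :: "'a::ring_1"
  shows "\<exists>h. (\<forall>t::nat. (x + of_nat t * y) ^ n = (\<Sum>k\<le>n. of_nat (t ^ k) * h k)) \<and>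
    h 0 = x ^ n \<and> h 1 = (\<Sum>i<n. x ^ i * y * x ^ (n - 1 - i)) \<and> (\<forall>k>n. h k = 0)"
proof (induction n)
  case 0
  show ?case by (rule exI[of _ "\<lambda>k. if k = 0 then 1 else 0"]) auto
next
  case (Suc n)
  then obtain h where h: "\<And>t::nat. (x + of_nat t * y) ^ n = (\<Sum>k\<le>n. of_nat (t ^ k) * h k)"
    "h 0 = x ^ n" "h 1 = (\<Sum>i<n. x ^ i * y * x ^ (n - 1 - i))" "\<And>k. k > n \<Longrightarrow> h k = 0" by metis
  \<comment> \<open>Words with \<open>k\<close> letters \<open>y\<close>, sorted by their last
    letter.\<close>
  define g where "g k = h k * x + (if k = 0 then 0 else h (k - 1) * y)" for k
  have "(x + of_nat t * y) ^ Suc n = (\<Sum>k\<le>Suc n. of_nat (t ^ k) * g k)" for t :: nat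
  proof -
    have "(\<Sum>k\<le>Suc n. of_nat (t ^ k) * g k) = (\<Sum>k\<le>Suc n. of_nat (t ^ k) * (h k * x)) +
        (\<Sum>k\<le>Suc n. of_nat (t ^ k) * (if k = 0 then 0 else h (k - 1) * y))"
      by (simp add: g_def ring_distribs sum.distrib del: sum.atMost_Suc)
    also have "(\<Sum>k\<le>Suc n. of_nat (t ^ k) * (h k * x)) = (\<Sum>k\<le>n. of_nat (t ^ k) * h k) * x"
      using h(4) by (simp add: sum_distrib_right mult.assoc)
    also have "(\<Sum>k\<le>Suc n. of_nat (t ^ k) * (if k = 0 then 0 else h (k - 1) * y)) =
       (\<Sum>k\<le>n. of_nat (t ^ Suc k) * (h k * y))"
      by (subst sum.atMost_Suc_shift) simp
    also have "\<dots> = (\<Sum>k\<le>n. of_nat (t ^ k) * h k) * (of_nat t * y)"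
      unfolding sum_distrib_right
    proof (rule sum.cong)
      fix k show "of_nat (t ^ Suc k) * (h k * y) = of_nat (t ^ k) * h k * (of_nat t * y)"
        by (simp add: mult.assoc mult_of_nat_commute)
    qed simp
    finally show ?thesis
      by (subst power_Suc2, subst h(1)) (simp add: distrib_left del: sum.atMost_Suc)
  qed
  moreover have "g 0 = x ^ Suc n" by (simp add: g_def h power_commutes)
  moreover have "g 1 = (\<Sum>i<Suc n. x ^ i * y * x ^ (Suc n - 1 - i))"
  proof -
    have "g 1 = (\<Sum>i<n. x ^ i * y * x ^ (n - 1 - i)) * x + x ^ n * y"
      using h by (simp add: g_def)
    also have "(\<Sum>i<n. x ^ i * y * x ^ (n - 1 - i)) * x = (\<Sum>i<n. x ^ i * y * x ^ (n - i))"
      unfolding sum_distrib_right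
    proof (rule sum.cong)
      fix i assume "i \<in> {..<n}"
      then have "n - i = Suc (n - 1 - i)" by auto
      then show "x ^ i * y * x ^ (n - 1 - i) * x = x ^ i * y * x ^ (n - i)"
        by (simp only: power_Suc2 mult.assoc)
    qed simp
    finally show ?thesis by simp
  qed
  moreover have "\<forall>k>Suc n. g k = 0" using h(4) by (auto simp: g_def)
  ultimately show ?case by blast
qed

text \<open>All elements \<open>x + of_nat t * y\<close> stay in \<open>P\<close>, so the polynomial
  of \<open>power_expansion\<close> takes values in \<open>J\<close>, and its coefficients lie there
  too.\<close>

lemma linearized_power_in_ideal:
  fixes J P :: "'a::ring_1 set"
  assumes J: "ideal_of_ring J" and P: "ideal_of_ring P"
    and inv: "\<And>k. k > 0 \<Longrightarrow> \<exists>r::'a. r * of_nat k = 1"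
    and nil: "\<And>x. x \<in> P \<Longrightarrow> x ^ Suc m \<in> J" and "x \<in> P" "y \<in> P"
  shows "(\<Sum>i\<le>m. x ^ i * y * x ^ (m - i)) \<in> J"
proof -
  obtain h where h: "\<And>t::nat. (x + of_nat t * y) ^ Suc m = (\<Sum>k\<le>Suc m. of_nat (t ^ k) * h k)"
    "h 1 = (\<Sum>i<Suc m. x ^ i * y * x ^ (Suc m - 1 - i))"
    using power_expansion[of x y "Suc m"] by metis
  have "h 1 \<in> J"
  proof (rule ideal_coefficients[OF J inv])
    show "(\<Sum>k\<le>Suc m. of_nat (t ^ k) * h k) \<in> J" for t :: nat
      unfolding h(1)[symmetric] using assms(5,6) by (intro nil ideal_add[OF P] ideal_lmult[OF P])
  qed simp_all
  then show ?thesis by (simp only: h(2) lessThan_Suc_atMost diff_Suc_1)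
qed

text \<open>For an ideal \<open>J\<close> this is the ideal generated by \<open>J\<close> and the
  m-th powers of elements of \<open>P\<close>. The inductive form permits induction over both outer
  factors in \<open>nagata_higman\<close>.\<close>

inductive_set power_ideal :: "'a::ring_1 set \<Rightarrow> 'a set \<Rightarrow> nat \<Rightarrow> 'a set"
  for J P m where
  base: "j \<in> J \<Longrightarrow> j \<in> power_ideal J P m"
| power: "x \<in> P \<Longrightarrow> u * x ^ m * v \<in> power_ideal J P m"
| add: "a \<in> power_ideal J P m \<Longrightarrow> b \<in> power_ideal J P m \<Longrightarrow> a + b \<in> power_ideal J P m"

lemma ideal_power_ideal:
  assumes J: "ideal_of_ring J"
  shows "ideal_of_ring (power_ideal J P m)"
proof -
  have "u * x \<in> power_ideal J P m \<and> x * u \<in> power_ideal J P m" if "x \<in> power_ideal J P m" for x u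
    using that
  proof induction
    case (base j)
    then show ?case by (auto intro: power_ideal.base ideal_lmult[OF J] ideal_rmult[OF J])
  next
    case (power x a v)
    then show ?case using power_ideal.power[of x P "u * a" m v J] power_ideal.power[of x P a m "v * u" J]
      by (simp add: mult.assoc)
  next
    case (add a b)
    then show ?case by (auto simp: algebra_simps intro: power_ideal.add)
  qed
  then show ?thesis unfolding ideal_of_ring_def
    by (auto intro: power_ideal.add power_ideal.base ideal_zero[OF J])
qed

text \<open>
  Higman's computation: \<open>\<Sum>\<^sub>i\<^sub>,\<^sub>j x\<^sup>i z y\<^sup>j x\<^sup>m\<^sup>-\<^sup>i y\<^sup>m\<^sup>-\<^sup>j\<close> lies in \<open>J\<close>, by linearization of the \<open>x\<close>-power
  for each \<open>j\<close>; summing over \<open>j\<close> first leaves only the term \<open>i = m\<close> modulo \<open>J\<close>.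
\<close>

lemma higman:
  fixes J P :: "'a::ring_1 set"
  assumes J: "ideal_of_ring J" and P: "ideal_of_ring P"
    and inv: "\<And>k. k > 0 \<Longrightarrow> \<exists>r::'a. r * of_nat k = 1"
    and nil: "\<And>x. x \<in> P \<Longrightarrow> x ^ Suc m \<in> J" and x: "x \<in> P" and y: "y \<in> P" and z: "z \<in> P"
  shows "x ^ m * z * y ^ m \<in> J"
proof -
  have lin: "(\<Sum>i\<le>m. x ^ i * y * x ^ (m - i)) \<in> J" if "x \<in> P" "y \<in> P" for x y
    by (rule linearized_power_in_ideal[OF J P inv nil that])
  let ?g = "\<lambda>i. x ^ i * z * (\<Sum>j\<le>m. y ^ j * x ^ (m - i) * y ^ (m - j))"
  have "(\<Sum>j\<le>m. (\<Sum>i\<le>m. x ^ i * (z * y ^ j) * x ^ (m - i)) * y ^ (m - j)) \<in> J"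
    using x z by (intro ideal_sum[OF J] ideal_rmult[OF J] lin ideal_rmult[OF P])
  also have "(\<Sum>j\<le>m. (\<Sum>i\<le>m. x ^ i * (z * y ^ j) * x ^ (m - i)) * y ^ (m - j)) = (\<Sum>i\<le>m. ?g i)"
    unfolding sum_distrib_right sum_distrib_left by (subst sum.swap) (simp add: mult.assoc)
  also have "\<dots> = (\<Sum>i<m. ?g i) + ?g m"
    by (simp only: lessThan_Suc_atMost[symmetric] sum.lessThan_Suc)
  finally have 1: "(\<Sum>i<m. ?g i) + ?g m \<in> J" .
  have 2: "(\<Sum>i<m. ?g i) \<in> J"
  proof (rule ideal_sum[OF J])
    fix i assume "i \<in> {..<m}"
    \<comment> \<open>\<open>P\<close> need not contain 1: a positive exponent is what puts
      \<open>x ^ (m - i)\<close> into it, and this is why the term \<open>i = m\<close>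
      survives.\<close>
    then have "m - i = Suc (m - i - 1)" by auto
    then have "x ^ (m - i) \<in> P" using ideal_rmult[OF P x, of "x ^ (m - i - 1)"] by (metis power_Suc)
    from ideal_lmult[OF J lin[OF y this]] show "?g i \<in> J" by simp
  qed
  from ideal_minus[OF J 1 2] have "?g m \<in> J" by simp
  also have "?g m = x ^ m * z * (of_nat (Suc m) * y ^ m)"
    by (simp flip: power_add)
  also have "\<dots> = of_int (int (Suc m)) * (x ^ m * z * y ^ m)"
    by (simp only: of_int_of_nat_eq) (metis mult.assoc mult_of_nat_commute)
  finally have *: "of_int (int (Suc m)) * (x ^ m * z * y ^ m) \<in> J" .
  show ?thesis by (rule ideal_cancel_int[OF J inv _ *]) simp_all
qed

text \<open>Let K be generated by \<open>J\<close> and the powers with exponent one less. Modulo K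
  the nil index has dropped, and Higman's computation puts K P K into \<open>J\<close>. Hence a
  product is in \<open>J\<close> once it splits into a left part in K, one factor from
  \<open>P\<close>, and a right part in K.\<close>

theorem nagata_higman:
  fixes J P :: "'a::ring_1 set"
  assumes J: "ideal_of_ring J" and P: "ideal_of_ring P"
    and inv: "\<And>k. k > 0 \<Longrightarrow> \<exists>r::'a. r * of_nat k = 1"
    and nil: "\<And>x. x \<in> P \<Longrightarrow> x ^ n \<in> J" and "set xs \<subseteq> P" "length xs = 2 ^ n - 1"
  shows "prod_list xs \<in> J"
  using J nil assms(5,6)
proof (induction n arbitrary: J xs)
  case 0
  \<comment> \<open>The empty product is 1 = 0^0, which the hypothesis for exponent 0 puts into
    \<open>J\<close>.\<close>
  then show ?case using "0"(2)[of 0] ideal_zero[OF P] by simp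
next
  case (Suc m)
  note J = Suc.prems(1)
  let ?K = "power_ideal J P m"
  have K: "ideal_of_ring ?K" by (rule ideal_power_ideal[OF J])
  have KP: "x ^ m \<in> ?K" if "x \<in> P" for x
    using power_ideal.power[OF that, of 1 m 1 J] by simp
  \<comment> \<open>The essential case has outer factors \<open>u * x ^ m * v\<close> and
    \<open>u' * y ^ m * v'\<close>. The middle \<open>v * z * u'\<close> then lies in
    \<open>P\<close> because \<open>z\<close> does, as \<open>higman\<close> requires.\<close>
  have prod: "a * z * b \<in> J" if "a \<in> ?K" "b \<in> ?K" "z \<in> P" for a b z
    using that(1)
  proof induction
    case (base j)
    then show ?case by (intro ideal_rmult[OF J])
  next
    case (power x u v)
    note x = power
    from that(2) show ?case
    proof induction
      case (base j)
      then show ?case by (intro ideal_lmult[OF J])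
    next
      case (power y u' v')
      have "x ^ m * (v * z * u') * y ^ m \<in> J"
        by (rule higman[OF J P inv Suc.prems(2) x power ideal_rmult[OF P ideal_lmult[OF P that(3)]]])
      then have "u * (x ^ m * (v * z * u') * y ^ m) * v' \<in> J"
        by (rule ideal_rmult[OF J ideal_lmult[OF J]])
      then show ?case by (simp add: mult.assoc)
    next
      case (add a b)
      then show ?case by (simp add: distrib_left ideal_add[OF J])
    qed
  next
    case (add a b)
    then show ?case by (simp add: distrib_right ideal_add[OF J])
  qed
  \<comment> \<open>2^(m+1) - 1 = N + 1 + N.\<close>
  let ?N = "2 ^ m - 1 :: nat"
  have len: "length xs = ?N + Suc ?N"
    using Suc.prems(4) one_le_power[of "2::nat" m] by simp
  have pos: "(0::nat) < 2 ^ m" by simp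
  have "xs = take ?N xs @ xs ! ?N # drop (Suc ?N) xs"
    using len by (intro id_take_nth_drop) linarith
  from arg_cong[OF this, of prod_list]
  have "prod_list xs = prod_list (take ?N xs) * xs ! ?N * prod_list (drop (Suc ?N) xs)"
    by (simp only: prod_list.append prod_list.Cons mult.assoc)
  moreover have "prod_list (take ?N xs) \<in> ?K" "prod_list (drop (Suc ?N) xs) \<in> ?K"
  proof -
    have *: "set (take ?N xs) \<subseteq> P" "set (drop (Suc ?N) xs) \<subseteq> P"
      by (rule subset_trans[OF set_take_subset Suc.prems(3)] subset_trans[OF set_drop_subset Suc.prems(3)])+
    have **: "length (take ?N xs) = ?N" "length (drop (Suc ?N) xs) = ?N"
      using len by simp_all
    show "prod_list (take ?N xs) \<in> ?K" "prod_list (drop (Suc ?N) xs) \<in> ?K"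
      using Suc.IH[OF K KP *(1) **(1)] Suc.IH[OF K KP *(2) **(2)] by simp_all
  qed
  moreover have "?N < length xs" using len by linarith
  then have "xs ! ?N \<in> P" by (rule subsetD[OF Suc.prems(3) nth_mem])
  ultimately show ?case using prod by simp
qed

section \<open>The Faddeev--LeVerrier recursion\<close>

text \<open>The signed sum over permutations of products of traces along cycles: the trace of the
  tensor product of the \<open>W p\<close> composed with the unnormalized antisymmetrizer. Index
  functions replace the cycle decomposition. The inverse is used because composing \<open>q\<close>
  with a transposition of \<open>a\<close> and \<open>b\<close> on the left changes it at
  \<open>a\<close> and \<open>b\<close> only.\<close>

definition perm_trace :: "nat set \<Rightarrow> (nat \<Rightarrow> 'a::comm_ring_1^'n^'n) \<Rightarrow> 'a"
  where "perm_trace S W = (\<Sum>q | q permutes S. of_int (sign q) *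
    (\<Sum>i\<in>S \<rightarrow>\<^sub>E UNIV. \<Prod>p\<in>S. W p $ i p $ i (inv_into UNIV q p)))"

lemma sum_PiE_insert:
  assumes "a \<notin> S"
  shows "(\<Sum>i\<in>insert a S \<rightarrow>\<^sub>E B. f i) = (\<Sum>x\<in>B. \<Sum>i\<in>S \<rightarrow>\<^sub>E B. f (i(a := x)))"
proof -
  have "(\<Sum>i\<in>insert a S \<rightarrow>\<^sub>E B. f i) = (\<Sum>(x, i)\<in>B \<times> (S \<rightarrow>\<^sub>E B). f (i(a := x)))"
    unfolding PiE_insert_eq
    using inj_combinator[OF assms, of "\<lambda>_. B"] by (subst sum.reindex) (auto simp: case_prod_unfold)
  then show ?thesis by (simp add: sum.cartesian_product)
qed

text \<open>Each permutation of the larger set is a transposition of \<open>a\<close> and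
  \<open>b\<close> after some \<open>q\<close> fixing \<open>a\<close>. For \<open>b = a\<close> the
  point \<open>a\<close> is a cycle of its own and contributes \<open>trace (W a)\<close>; otherwise
  it is inserted into the cycle next to \<open>b\<close>, which merges two factors into
  \<open>W b ** W a\<close> and reverses the sign.\<close>

lemma perm_trace_insert:
  fixes W :: "nat \<Rightarrow> 'a::comm_ring_1^'n^'n"
  assumes "finite S" "a \<notin> S"
  shows "perm_trace (insert a S) W =
    trace (W a) * perm_trace S W - (\<Sum>b\<in>S. perm_trace S (W(b := W b ** W a)))"
proof -
  define G where "G q = of_int (sign q) *
    (\<Sum>i\<in>insert a S \<rightarrow>\<^sub>E UNIV. \<Prod>p\<in>insert a S. W p $ i p $ i (inv_into UNIV q p))" for q
  have fixa: "G (Transposition.transpose a a \<circ> q) = trace (W a) *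
     (of_int (sign q) * (\<Sum>i\<in>S \<rightarrow>\<^sub>E UNIV. \<Prod>p\<in>S. W p $ i p $ i (inv_into UNIV q p)))"
    if q: "q permutes S" for q
  proof -
    have iq: "inv_into UNIV q permutes S" using q by (rule permutes_inv)
    have [simp]: "inv_into UNIV q a = a" using permutes_not_in[OF iq assms(2)] .
    have "(\<Prod>p\<in>insert a S. W p $ (i(a := x)) p $ (i(a := x)) (inv_into UNIV q p)) =
      W a $ x $ x * (\<Prod>p\<in>S. W p $ i p $ i (inv_into UNIV q p))" for i x
    proof -
      have "(\<Prod>p\<in>S. W p $ (i(a := x)) p $ (i(a := x)) (inv_into UNIV q p)) = (\<Prod>p\<in>S. W p $ i p $ i (inv_into UNIV q p))"
        using assms(2) permutes_in_image[OF iq] by (intro prod.cong) auto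
      with assms show ?thesis by simp
    qed
    then show ?thesis
      using assms(2) unfolding G_def trace_def sum_PiE_insert[OF assms(2)]
      by (subst sum.swap) (simp add: sum_distrib_left sum_distrib_right mult_ac)
  qed
  have moveb: "G (Transposition.transpose a b \<circ> q) = - (of_int (sign q) *
      (\<Sum>i\<in>S \<rightarrow>\<^sub>E UNIV. \<Prod>p\<in>S. (W(b := W b ** W a)) p $ i p $ i (inv_into UNIV q p)))"
    if q: "q permutes S" and b: "b \<in> S" for q b
  proof -
    have iq: "inv_into UNIV q permutes S" using q by (rule permutes_inv)
    have iqa: "inv_into UNIV q a = a" using permutes_not_in[OF iq assms(2)] .
    have ab: "a \<noteq> b" using assms(2) b by auto
    have bq: "bij q" using q by (rule permutes_bij)
    have inv_comp: "inv_into UNIV (Transposition.transpose a b \<circ> q) = inv_into UNIV q \<circ> Transposition.transpose a b"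
      using bq by (simp add: o_inv_distrib)
    have pq: "permutation q" using permutation_permutes assms(1) q by blast
    have sgn: "sign (Transposition.transpose a b \<circ> q) = - sign q"
      using ab pq by (simp add: sign_compose sign_swap_id permutation_swap_id)
    \<comment> \<open>The index \<open>x\<close> at \<open>a\<close> occurs once as a column of
      \<open>W b\<close> and once as a row of \<open>W a\<close>, so summing over it forms the
      matrix product.\<close>
    have "(\<Prod>p\<in>insert a S. W p $ (i(a := x)) p $ (i(a := x)) ((inv_into UNIV q \<circ> Transposition.transpose a b) p)) =
       (W b $ i b $ x * W a $ x $ i (inv_into UNIV q b)) * (\<Prod>p\<in>S - {b}. W p $ i p $ i (inv_into UNIV q p))" for i x
    proof -
      have in1: "inv_into UNIV q b \<in> S" using permutes_in_image[OF iq] b by simp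
      have "(\<Prod>p\<in>S. W p $ (i(a := x)) p $ (i(a := x)) ((inv_into UNIV q \<circ> Transposition.transpose a b) p)) =
        W b $ i b $ x * (\<Prod>p\<in>S - {b}. W p $ (i(a := x)) p $ (i(a := x)) ((inv_into UNIV q \<circ> Transposition.transpose a b) p))"
        using assms(1) b ab by (subst prod.remove[of _ b]) (auto simp: iqa)
      also have "(\<Prod>p\<in>S - {b}. W p $ (i(a := x)) p $ (i(a := x)) ((inv_into UNIV q \<circ> Transposition.transpose a b) p)) =
        (\<Prod>p\<in>S - {b}. W p $ i p $ i (inv_into UNIV q p))"
      proof (rule prod.cong)
        fix p assume p: "p \<in> S - {b}"
        then have "p \<noteq> a" "inv_into UNIV q p \<in> S" using assms(2) permutes_in_image[OF iq] by auto
        with p assms(2) show "W p $ (i(a := x)) p $ (i(a := x)) ((inv_into UNIV q \<circ> Transposition.transpose a b) p) = W p $ i p $ i (inv_into UNIV q p)"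
          by (auto simp: Transposition.transpose_def)
      qed simp
      finally show ?thesis using assms in1 by (auto simp: mult_ac)
    qed
    then have "(\<Sum>i\<in>insert a S \<rightarrow>\<^sub>E UNIV. \<Prod>p\<in>insert a S. W p $ i p $ i ((inv_into UNIV q \<circ> Transposition.transpose a b) p)) =
      (\<Sum>i\<in>S \<rightarrow>\<^sub>E UNIV. \<Sum>x\<in>UNIV. (W b $ i b $ x * W a $ x $ i (inv_into UNIV q b)) * (\<Prod>p\<in>S - {b}. W p $ i p $ i (inv_into UNIV q p)))"
      using assms(2) by (subst sum.swap) (simp add: sum_PiE_insert)
    also have "\<dots> = (\<Sum>i\<in>S \<rightarrow>\<^sub>E UNIV. \<Prod>p\<in>S. (W(b := W b ** W a)) p $ i p $ i (inv_into UNIV q p))"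
    proof (rule sum.cong)
      fix i :: "nat \<Rightarrow> 'n"
      have "(\<Prod>p\<in>S. (W(b := W b ** W a)) p $ i p $ i (inv_into UNIV q p)) =
        (W b ** W a) $ i b $ i (inv_into UNIV q b) * (\<Prod>p\<in>S - {b}. W p $ i p $ i (inv_into UNIV q p))"
        using assms(1) b by (subst prod.remove[of _ b]) auto
      then show "(\<Sum>x\<in>UNIV. (W b $ i b $ x * W a $ x $ i (inv_into UNIV q b)) * (\<Prod>p\<in>S - {b}. W p $ i p $ i (inv_into UNIV q p))) =
         (\<Prod>p\<in>S. (W(b := W b ** W a)) p $ i p $ i (inv_into UNIV q p))"
        by (simp add: matrix_matrix_mult_def sum_distrib_right)
    qed simp
    finally show ?thesis by (simp add: G_def inv_comp sgn)
  qed
  have "perm_trace (insert a S) W = (\<Sum>b\<in>insert a S. \<Sum>q | q permutes S. G (Transposition.transpose a b \<circ> q))"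
    unfolding perm_trace_def G_def[symmetric] by (rule sum_over_permutations_insert[OF assms])
  also have "\<dots> = (\<Sum>q | q permutes S. G (Transposition.transpose a a \<circ> q)) +
      (\<Sum>b\<in>S. \<Sum>q | q permutes S. G (Transposition.transpose a b \<circ> q))"
    using assms by simp
  also have "(\<Sum>q | q permutes S. G (Transposition.transpose a a \<circ> q)) = trace (W a) * perm_trace S W"
    unfolding perm_trace_def sum_distrib_left[where r = "trace (W a)"] using fixa by (intro sum.cong) auto
  also have "(\<Sum>b\<in>S. \<Sum>q | q permutes S. G (Transposition.transpose a b \<circ> q)) =
      (\<Sum>b\<in>S. - perm_trace S (W(b := W b ** W a)))"
    unfolding perm_trace_def sum_negf[symmetric] using moveb by (intro sum.cong) auto
  finally show ?thesis by (simp add: sum_negf)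
qed

text \<open>For a fixed index tuple with \<open>i r = i s\<close>, composing \<open>q\<close> with the transposition of \<open>r\<close> and \<open>s\<close> reverses the sign only.\<close>

lemma perm_trace_eq_0:
  fixes W :: "nat \<Rightarrow> 'a::comm_ring_1^'n^'n"
  assumes "finite S" "card S > CARD('n)" and two: "\<And>x::'a. x + x = 0 \<Longrightarrow> x = 0"
  shows "perm_trace S W = 0"
proof -
  have "perm_trace S W = (\<Sum>i\<in>S \<rightarrow>\<^sub>E UNIV. \<Sum>q | q permutes S. of_int (sign q) *
    (\<Prod>p\<in>S. W p $ i p $ i (inv_into UNIV q p)))"
    unfolding perm_trace_def sum_distrib_left by (rule sum.swap)
  also have "\<dots> = 0"
  proof (rule sum.neutral, intro ballI)
    fix i :: "nat \<Rightarrow> 'n"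
    have "\<not> inj_on i S"
      using assms(2) card_inj_on_le[of i S UNIV] by auto
    then obtain r s where rs: "r \<in> S" "s \<in> S" "r \<noteq> s" "i r = i s" by (auto simp: inj_on_def)
    let ?t = "Transposition.transpose r s"
    define g where "g q = (of_int (sign q) :: 'a) * (\<Prod>p\<in>S. W p $ i p $ i (inv_into UNIV q p))" for q
    have it: "i (?t x) = i x" for x using rs(4) by (auto simp: Transposition.transpose_def)
    have tp: "?t permutes S" using rs by (simp add: permutes_swap_id)
    have "g (q \<circ> ?t) = - g q" if "q permutes S" for q
    proof -
      have "permutation q" using permutation_permutes assms(1) that by blast
      then have "sign (q \<circ> ?t) = - sign q" using rs(3)
        by (simp add: sign_compose sign_swap_id permutation_swap_id)
      moreover have "inv_into UNIV (q \<circ> ?t) = ?t \<circ> inv_into UNIV q"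
        using permutes_bij[OF that] by (simp add: o_inv_distrib)
      ultimately show ?thesis by (simp add: g_def it)
    qed
    then have "(\<Sum>q | q permutes S. g q) = - (\<Sum>q | q permutes S. g q)"
      by (subst sum_permutations_compose_right[OF tp]) (simp flip: sum_negf)
    then have "(\<Sum>q | q permutes S. g q) + (\<Sum>q | q permutes S. g q) = 0"
      by (metis add.right_inverse)
    then show "(\<Sum>q | q permutes S. of_int (sign q) * (\<Prod>p\<in>S. W p $ i p $ i (inv_into UNIV q p))) = 0"
      unfolding g_def[symmetric] by (rule two)
  qed
  finally show ?thesis .
qed

text \<open>Up to signs and the factor \<open>k!\<close>, these are the matrices of the Faddeev--LeVerrier recursion.\<close>

primrec leverrier :: "'a::comm_ring_1^'n^'n \<Rightarrow> nat \<Rightarrow> 'a^'n^'n" where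
  "leverrier M 0 = mat 1"
| "leverrier M (Suc k) = mat (trace (M ** leverrier M k)) - mat (of_nat (Suc k)) ** (leverrier M k ** M)"

lemma mat_mult_entry [simp]: "(mat f ** A) $ i $ j = f * A $ i $ j"
  for A :: "'a::comm_ring_1^'m^'n::finite"
  by (simp add: matrix_matrix_mult_def mat_def if_distrib[of "\<lambda>x. x * _"] cong: if_cong)

lemma mult_mat_entry [simp]: "(A ** mat f) $ i $ j = A $ i $ j * f"
  for A :: "'a::comm_ring_1^'n::finite^'m"
  by (simp add: matrix_matrix_mult_def mat_def if_distrib[of "\<lambda>x. _ * x"] cong: if_cong)

lemma mat_central: "mat f ** A = A ** mat f" for A :: "'a::comm_ring_1^'n::finite^'n"
  by (simp add: vec_eq_iff mult.commute)

lemma trace_mat_mult [simp]: "trace (mat f ** A) = f * trace A" for A :: "'a::comm_ring_1^'n::finite^'n"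
  by (simp add: trace_def sum_distrib_left)

lemma matrix_sub_ldistrib: "A ** (B - C) = A ** B - A ** C" for A :: "'a::comm_ring_1^'n::finite^'m"
  by (simp add: vec_eq_iff matrix_matrix_mult_def algebra_simps sum_subtractf)

text \<open>One slot is kept free for \<open>N\<close>, the others hold \<open>M\<close>. On
  expanding at the free slot, the summands over \<open>S\<close> agree by symmetry, which produces
  the factor \<open>Suc k\<close>; the result is again the trace of \<open>N\<close> times a matrix,
  and this matrix obeys the recursion of \<open>leverrier\<close>.\<close>

lemma perm_trace_leverrier:
  fixes M :: "'a::comm_ring_1^'n^'n"
  assumes "finite S" "b \<notin> S"
  shows "perm_trace (insert b S) ((\<lambda>_. M)(b := N)) = trace (N ** leverrier M (card S))"
  using assms
proof (induction "card S" arbitrary: S b N)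
  case 0
  then have "S = {}" by simp
  then show ?case using perm_trace_insert[of "{}" b "(\<lambda>_. M)(b := N)"]
    by (simp add: perm_trace_def)
next
  case (Suc k)
  let ?T = "leverrier M k"
  have sub: "perm_trace S ((\<lambda>_. M)(c := N')) = trace (N' ** ?T)" if "c \<in> S" for c N'
  proof -
    have "k = card (S - {c})" using that Suc(2,3) by simp
    then have "perm_trace (insert c (S - {c})) ((\<lambda>_. M)(c := N')) = trace (N' ** ?T)"
      using Suc.hyps(1)[of "S - {c}" c N'] Suc(3) by simp
    then show ?thesis using that by (simp add: insert_absorb)
  qed
  have cong: "perm_trace S W = perm_trace S W'" if "\<And>p. p \<in> S \<Longrightarrow> W p = W' p" for W W' :: "nat \<Rightarrow> 'a^'n^'n"
    unfolding perm_trace_def using that by simp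
  obtain c where c: "c \<in> S" using Suc(2) by fastforce
  \<comment> \<open>The value at \<open>b\<close> is invisible on \<open>S\<close>, so all slots
    hold \<open>M\<close>; any \<open>c\<close> may play the free one.\<close>
  have e: "perm_trace S ((\<lambda>_. M)(b := N)) = trace (M ** ?T)"
  proof -
    have "perm_trace S ((\<lambda>_. M)(b := N)) = perm_trace S ((\<lambda>_. M)(c := M))"
      by (rule cong) (use Suc(4) in auto)
    then show ?thesis using sub[OF c, of M] by simp
  qed
  have *: "perm_trace S (((\<lambda>_. M)(b := N))(d := M ** N)) = trace (M ** N ** ?T)" if "d \<in> S" for d
  proof -
    have "perm_trace S (((\<lambda>_. M)(b := N))(d := M ** N)) = perm_trace S ((\<lambda>_. M)(d := M ** N))"
      by (rule cong) (use Suc(4) in auto)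
    then show ?thesis using sub[OF that] by simp
  qed
  have "perm_trace (insert b S) ((\<lambda>_. M)(b := N)) =
     trace N * trace (M ** ?T) - (\<Sum>d\<in>S. trace (M ** N ** ?T))"
  proof -
    have "((\<lambda>_. M)(b := N)) d ** ((\<lambda>_. M)(b := N)) b = M ** N" if "d \<in> S" for d
      using that Suc(4) by auto
    then show ?thesis
      using perm_trace_insert[OF Suc(3,4), of "(\<lambda>_. M)(b := N)"] e *
      by (simp cong: sum.cong)
  qed
  also have "\<dots> = trace (N ** leverrier M (Suc k))"
  proof -
    have "trace (M ** N ** ?T) = trace (N ** (?T ** M))"
      by (metis matrix_mul_assoc trace_mul_sym)
    moreover have "trace (N ** mat f) = f * trace N" for f :: 'a
      by (metis mat_central trace_mat_mult)
    moreover have "N ** (mat f ** A) = mat f ** (N ** A)" for f and A :: "'a^'n^'n"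
      by (metis mat_central matrix_mul_assoc)
    ultimately show ?thesis using Suc(2)[symmetric]
      by (simp add: matrix_sub_ldistrib trace_sub mult.commute)
  qed
  finally show ?case using Suc(2) by simp
qed

lemma trace_nondegenerate:
  fixes A :: "'a::comm_ring_1^'n^'n"
  assumes "\<And>N. trace (N ** A) = 0"
  shows "A = 0"
proof (simp only: vec_eq_iff zero_index, intro allI)
  fix i j
  let ?N = "(\<chi> r s. if r = j \<and> s = i then 1 else 0) :: 'a^'n^'n"
  have "trace (?N ** A) = (\<Sum>r\<in>UNIV. if r = j then A $ i $ r else 0)"
    unfolding trace_def matrix_matrix_mult_def
    by (intro sum.cong) (auto simp: if_distrib[of "\<lambda>x. x * _"] cong: if_cong)
  also have "\<dots> = A $ i $ j" by simp
  finally show "A $ i $ j = 0" using assms by simp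
qed

text \<open>Cayley-Hamilton with trace coefficients: n slots for \<open>M\<close> and one for
  \<open>N\<close> are too many, so the antisymmetrized trace vanishes for every \<open>N\<close>,
  and the trace form is nondegenerate.\<close>

theorem leverrier_card_eq_0:
  fixes M :: "'a::comm_ring_1^'n^'n"
  assumes "\<And>x::'a. x + x = 0 \<Longrightarrow> x = 0"
  shows "leverrier M CARD('n) = 0"
proof (rule trace_nondegenerate)
  fix N :: "'a^'n^'n"
  show "trace (N ** leverrier M CARD('n)) = 0"
    using perm_trace_leverrier[of "{..<CARD('n)}" "CARD('n)" M N]
      perm_trace_eq_0[of "insert CARD('n) {..<CARD('n)}" "(\<lambda>_. M)(CARD('n) := N)"] assms
    by simp
qed

section \<open>Linear maps\<close>

lemma lookup_cscale [simp]: "Poly_Mapping.lookup (cscale c p) k = c * Poly_Mapping.lookup p k"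
  unfolding cscale_def by (simp add: Poly_Mapping.map.rep_eq when_def)

lemma cscale_simps:
  shows cscale_add: "cscale c (p + q) = cscale c p + cscale c q"
    and cscale_add_left: "cscale (c + d) p = cscale c p + cscale d p"
    and cscale_cscale [simp]: "cscale c (cscale d p) = cscale (c * d) p"
    and cscale_one [simp]: "cscale 1 p = p"
    and cscale_zero_left [simp]: "cscale 0 p = 0"
    and cscale_zero [simp]: "cscale c 0 = 0"
    and cscale_minus [simp]: "cscale c (- p) = - cscale c p"
  by (auto intro!: poly_mapping_eqI simp: lookup_add algebra_simps)

interpretation cvs: vector_space "cscale :: complex \<Rightarrow> ('k \<Rightarrow>\<^sub>0 complex) \<Rightarrow> _"
  by unfold_locales (simp_all add: cscale_add cscale_add_left)

abbreviation clinear :: "(('k \<Rightarrow>\<^sub>0 complex) \<Rightarrow> ('l \<Rightarrow>\<^sub>0 complex)) \<Rightarrow> bool"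
  where "clinear F \<equiv> Vector_Spaces.linear cscale cscale F"

lemma clinearI:
  "(\<And>p q. F (p + q) = F p + F q) \<Longrightarrow> (\<And>c p. F (cscale c p) = cscale c (F p)) \<Longrightarrow> clinear F"
  by unfold_locales

lemma clinear_simps:
  assumes "clinear F"
  shows "F (p + q) = F p + F q" "F (cscale c p) = cscale c (F p)" "F 0 = 0" "F (- p) = - F p" "F (p - q) = F p - F q"
proof -
  interpret Vector_Spaces.linear cscale cscale F by fact
  show "F (p + q) = F p + F q" "F (cscale c p) = cscale c (F p)" "F 0 = 0" "F (- p) = - F p" "F (p - q) = F p - F q"
    by (simp_all add: add scale neg diff)
qed

lemma clinear_sum:
  assumes "clinear F"
  shows "F (sum f A) = (\<Sum>i\<in>A. F (f i))"
  by (induction A rule: infinite_finite_induct) (simp_all add: clinear_simps[OF assms])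

lemma lin_extend_superset:
  assumes "finite A" "Poly_Mapping.keys p \<subseteq> A"
  shows "lin_extend f p = (\<Sum>k\<in>A. cscale (Poly_Mapping.lookup p k) (f k))"
  unfolding lin_extend_def using assms
  by (intro sum.mono_neutral_left) (auto simp: in_keys_iff)

lemma lin_extend_linear: "clinear (lin_extend f)"
proof (rule clinearI)
  fix p q :: "'a \<Rightarrow>\<^sub>0 complex" and c
  let ?A = "Poly_Mapping.keys p \<union> Poly_Mapping.keys q"
  show "lin_extend f (p + q) = lin_extend f p + lin_extend f q"
    using keys_add[of p q]
    by (simp add: lin_extend_superset[of ?A] lookup_add cscale_add_left sum.distrib)
  have "Poly_Mapping.keys (cscale c p) \<subseteq> Poly_Mapping.keys p" by (auto simp: in_keys_iff)
  then show "lin_extend f (cscale c p) = cscale c (lin_extend f p)"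
    by (simp add: lin_extend_superset[of "Poly_Mapping.keys p"] cvs.scale_sum_right)
qed

lemmas lin_extend_simps [simp] = clinear_simps[OF lin_extend_linear]

lemma lin_extend_basis [simp]: "lin_extend f (basis k) = f k"
  by (simp add: lin_extend_def basis_def)

lemma basis_expansion: "p = (\<Sum>k\<in>Poly_Mapping.keys p. cscale (Poly_Mapping.lookup p k) (basis k))"
  by (rule poly_mapping_eqI)
    (auto simp: lookup_sum basis_def lookup_single when_def if_distrib in_keys_iff cong: if_cong)

lemma basis_induct [case_names basis add scale]:
  assumes "\<And>k. P (basis k)" "\<And>p q. P p \<Longrightarrow> P q \<Longrightarrow> P (p + q)" "\<And>c p. P p \<Longrightarrow> P (cscale c p)"
  shows "P p"
proof -
  have P0: "P 0" using assms(3)[OF assms(1), of 0] by simp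
  have "P (\<Sum>k\<in>A. cscale (Poly_Mapping.lookup p k) (basis k))" for A
    by (induction A rule: infinite_finite_induct) (auto intro: P0 assms)
  then show ?thesis using basis_expansion by metis
qed

lemma clinear_eq:
  assumes "clinear F" "clinear G" "\<And>k. F (basis k) = G (basis k)"
  shows "F p = G p"
  by (induction p rule: basis_induct) (simp_all add: assms clinear_simps[OF assms(1)] clinear_simps[OF assms(2)])

lemma basis_mult: "basis a * basis b = basis (a + b)"
  by (simp add: basis_def mult_single)

lemma one_basis: "1 = basis 0"
  by (simp add: basis_def)

lemma basis_Nil: "basis [] = 1"
  by (simp add: one_basis zero_list_def)

lemma cscale_mult_left [simp]: "cscale c p * q = cscale c (p * q)"
  by (simp add: cscale_def mult_map_scale_conv_mult mult.assoc)

text \<open>Scaling is left multiplication by a constant; moving it past \<open>p\<close> needs that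
  constants are central even over a noncommutative monoid.\<close>

lemma cscale_mult_right [simp]: "p * cscale c q = cscale c (p * q)"
proof -
  have "p * Poly_Mapping.single 0 c = Poly_Mapping.single 0 c * p"
  proof (induction p rule: basis_induct)
    case (basis k)
    then show ?case by (simp add: basis_def mult_single)
  next
    case (add p q)
    then show ?case by (simp add: algebra_simps)
  next
    case (scale d p)
    then have "cscale d (p * Poly_Mapping.single 0 c) =
        Poly_Mapping.single 0 d * (Poly_Mapping.single 0 c * p)"
      by (simp add: cscale_def mult_map_scale_conv_mult)
    also have "\<dots> = Poly_Mapping.single 0 c * (Poly_Mapping.single 0 d * p)"
      by (simp add: mult.assoc[symmetric] mult_single mult.commute[of c])
    finally show ?case by (simp, simp add: cscale_def mult_map_scale_conv_mult)
  qed
  then show ?thesis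
    by (metis cscale_def mult_map_scale_conv_mult mult.assoc)
qed

lemma tensor_basis [simp]: "tensor (basis u) (basis v) = basis (u, v)"
  by (simp add: tensor_def)

lemma tensor_linear_left: "clinear (\<lambda>p. tensor p q)"
  unfolding tensor_def by (rule lin_extend_linear)

lemma lin_extend_fun_simps:
  shows "lin_extend (\<lambda>k. f k + g k) p = lin_extend f p + lin_extend g p"
    "lin_extend (\<lambda>k. cscale c (f k)) p = cscale c (lin_extend f p)"
    "lin_extend (\<lambda>k. - f k) p = - lin_extend f p"
  by (simp_all add: lin_extend_def cscale_add sum.distrib cvs.scale_sum_right mult.commute sum_negf)

lemma tensor_linear_right: "clinear (\<lambda>q. tensor p q)"
  unfolding tensor_def by (rule clinearI) (simp_all add: lin_extend_fun_simps)

lemmas tensor_simps = clinear_simps[OF tensor_linear_left] clinear_simps[OF tensor_linear_right]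

lemma clinear_compose: "clinear F \<Longrightarrow> clinear G \<Longrightarrow> clinear (\<lambda>p. F (G p))"
  by (rule clinearI) (simp_all add: clinear_simps)

lemma mult_linear_left: "clinear F \<Longrightarrow> clinear (\<lambda>p. a * F p)"
  and mult_linear_right: "clinear F \<Longrightarrow> clinear (\<lambda>p. F p * a)"
  by (auto intro!: clinearI simp: clinear_simps distrib_left distrib_right)

lemma sum_linear: "(\<And>i. i \<in> A \<Longrightarrow> clinear (F i)) \<Longrightarrow> clinear (\<lambda>p. \<Sum>i\<in>A. F i p)"
  by (rule clinearI) (auto simp: clinear_simps sum.distrib cvs.scale_sum_right)

section \<open>The coordinate ring\<close>

definition partial_deriv :: "'v \<Rightarrow> (('v \<Rightarrow>\<^sub>0 nat) \<Rightarrow>\<^sub>0 complex) \<Rightarrow> (('v \<Rightarrow>\<^sub>0 nat) \<Rightarrow>\<^sub>0 complex)"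
  where "partial_deriv s = lin_extend (\<lambda>m. cscale (of_nat (Poly_Mapping.lookup m s)) (basis (m - Poly_Mapping.single s 1)))"

lemma partial_deriv_linear: "clinear (partial_deriv s)"
  unfolding partial_deriv_def by (rule lin_extend_linear)

lemmas partial_deriv_simps = clinear_simps[OF partial_deriv_linear]

lemma partial_deriv_mult: "partial_deriv s (p * q) = p * partial_deriv s q + partial_deriv s p * q"
proof -
  \<comment> \<open>Subtraction of exponents truncates at 0, but exactly there the coefficient is
    0.\<close>
  have shift: "cscale (of_nat (Poly_Mapping.lookup b s)) (basis (a + (b - Poly_Mapping.single s 1))) =
    cscale (of_nat (Poly_Mapping.lookup b s)) (basis (a + b - Poly_Mapping.single s 1))" for a b :: "'a \<Rightarrow>\<^sub>0 nat"
  proof (cases "Poly_Mapping.lookup b s = 0")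
    case False
    then have "a + (b - Poly_Mapping.single s 1) = a + b - Poly_Mapping.single s 1"
      by (intro poly_mapping_eqI) (auto simp: lookup_add lookup_minus lookup_single when_def)
    then show ?thesis by simp
  qed simp
  show ?thesis
  proof (induction p rule: basis_induct)
    case (basis a)
    show ?case
    proof (induction q rule: basis_induct)
      case (basis b)
      show ?case
        using shift[of b a] shift[of a b]
        by (auto simp: partial_deriv_def basis_mult lookup_add cscale_add_left add.commute)
    qed (simp_all add: partial_deriv_simps distrib_left cscale_add)
  qed (simp_all add: partial_deriv_simps distrib_right cscale_add)
qed

lemma partial_deriv_var: "partial_deriv s (basis (Poly_Mapping.single t 1)) = (if s = t then 1 else 0)"
  by (simp add: partial_deriv_def one_basis lookup_single)

text \<open>The biderivation with prescribed values \<open>\<beta>\<close> on the variables. Written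
  with partial derivatives, it inherits bilinearity and both Leibniz rules from them, and
  well-definedness is no issue.\<close>

definition coord_bracket :: "('v::finite \<Rightarrow> 'v \<Rightarrow> (('v \<Rightarrow>\<^sub>0 nat) \<Rightarrow>\<^sub>0 complex)) \<Rightarrow>
    (('v \<Rightarrow>\<^sub>0 nat) \<Rightarrow>\<^sub>0 complex) \<Rightarrow> (('v \<Rightarrow>\<^sub>0 nat) \<Rightarrow>\<^sub>0 complex) \<Rightarrow> (('v \<Rightarrow>\<^sub>0 nat) \<Rightarrow>\<^sub>0 complex)"
  where "coord_bracket \<beta> f g = (\<Sum>s\<in>UNIV. \<Sum>t\<in>UNIV. partial_deriv s f * partial_deriv t g * \<beta> s t)"

lemma coord_bracket_linear_right: "clinear (coord_bracket \<beta> f)"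
  unfolding coord_bracket_def
  by (intro sum_linear mult_linear_left mult_linear_right partial_deriv_linear)

lemma coord_bracket_linear_left: "clinear (\<lambda>f. coord_bracket \<beta> f g)"
  unfolding coord_bracket_def
  by (intro sum_linear mult_linear_left mult_linear_right partial_deriv_linear)

lemma coord_bracket_mult_right:
  "coord_bracket \<beta> f (g * h) = g * coord_bracket \<beta> f h + coord_bracket \<beta> f g * h"
  by (simp add: coord_bracket_def partial_deriv_mult algebra_simps sum.distrib sum_distrib_left sum_distrib_right)

lemma coord_bracket_mult_left:
  "coord_bracket \<beta> (f * g) h = f * coord_bracket \<beta> g h + g * coord_bracket \<beta> f h"
  by (simp add: coord_bracket_def partial_deriv_mult algebra_simps sum.distrib sum_distrib_left sum_distrib_right)

lemma coord_bracket_antisym: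
  assumes "\<And>s t. \<beta> s t = - \<beta> t s"
  shows "coord_bracket \<beta> f g = - coord_bracket \<beta> g f"
  unfolding coord_bracket_def
  by (subst sum.swap, subst assms) (simp add: sum_negf[symmetric] mult.commute)

lemma coord_bracket_vars:
  "coord_bracket \<beta> (basis (Poly_Mapping.single s 1)) (basis (Poly_Mapping.single t 1)) = \<beta> s t"
  unfolding coord_bracket_def partial_deriv_var
  by (simp add: if_distrib[of "\<lambda>x. x * _"] if_distrib[of "\<lambda>x. _ * x"] cong: if_cong)

lemmas coord_bracket_simps = clinear_simps[OF coord_bracket_linear_left] clinear_simps[OF coord_bracket_linear_right]
lemmas coord_bracket_sum_left = clinear_sum[OF coord_bracket_linear_left]
lemmas coord_bracket_sum_right = clinear_sum[OF coord_bracket_linear_right]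

lemma coord_bracket_one [simp]: "coord_bracket \<beta> f 1 = 0" "coord_bracket \<beta> 1 f = 0"
  using coord_bracket_mult_right[of \<beta> f 1 1] coord_bracket_mult_left[of \<beta> 1 1 f] by simp_all

section \<open>Van den Bergh's bracket\<close>

lemma word_matrix_append: "word_matrix (x @ y) = word_matrix x ** word_matrix y"
  by (induction x) (simp_all add: matrix_mul_assoc)

lemma gmatrix_scale_entry [simp]: "gmatrix_scale c M $ k $ l = cscale c (M $ k $ l)"
  by (simp add: gmatrix_scale_def)

lemma eval_generic_entry: "eval_generic a $ u $ v = lin_extend (\<lambda>w. word_matrix w $ u $ v) a"
  by (simp add: eval_generic_def lin_extend_def)

lemma eval_generic_basis [simp]: "eval_generic (basis w) = word_matrix w"
  by (simp add: vec_eq_iff eval_generic_entry)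

lemma eval_generic_simps:
  shows "eval_generic (a + b) = eval_generic a + eval_generic b"
    "eval_generic (cscale c a) = gmatrix_scale c (eval_generic a)"
    "eval_generic (- a) = - eval_generic a"
    "eval_generic 0 = 0"
  by (simp_all add: vec_eq_iff eval_generic_entry)

text \<open>In Van den Bergh's formula the outer indices \<open>u\<close>, \<open>v\<close> belong
  to the second argument of the bracket and the inner ones \<open>l\<close>, \<open>k\<close> to the
  first; summing over \<open>l = k\<close> contracts the tensor to its product
  \<open>mu\<close>.\<close>

definition tensor_entry :: "'d free_alg2 \<Rightarrow> 'n \<Rightarrow> 'n \<Rightarrow> 'n \<Rightarrow> 'n::finite \<Rightarrow> ('d, 'n) coord_ring"
  where "tensor_entry t u l k v = lin_extend (\<lambda>(x, y). word_matrix x $ u $ l * word_matrix y $ k $ v) t"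

lemma tensor_entry_linear: "clinear (\<lambda>t. tensor_entry t u l k v)"
  unfolding tensor_entry_def by (rule lin_extend_linear)

lemmas tensor_entry_simps = clinear_simps[OF tensor_entry_linear]

lemma opposite_linear: "clinear opposite"
  unfolding opposite_def by (rule lin_extend_linear)

lemma mu_linear: "clinear mu"
  unfolding mu_def by (rule lin_extend_linear)

lemmas mu_simps = clinear_simps[OF mu_linear]

lemma opposite_basis [simp]: "opposite (basis (x, y)) = basis (y, x)"
  by (simp add: opposite_def)

lemma mu_basis [simp]: "mu (basis (x, y)) = basis (x @ y)"
  by (simp add: mu_def)

lemma opposite_opposite [simp]: "opposite (opposite t) = t"
proof -
  have "clinear (\<lambda>t. opposite (opposite t))" "clinear (\<lambda>t :: 'a free_alg2. t)"
    by (auto intro!: clinearI simp: clinear_simps[OF opposite_linear])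
  then show ?thesis by (rule clinear_eq) (auto simp: split_paired_all)
qed

lemma tensor_entry_opposite: "tensor_entry (opposite t) u l k v = tensor_entry t k v u l"
  by (rule clinear_eq[OF clinear_compose[OF tensor_entry_linear opposite_linear] tensor_entry_linear])
     (auto simp: tensor_entry_def mult.commute)

lemma outer_linear: "clinear (\<lambda>t. outer a t c)"
  unfolding outer_def by (rule clinearI) (simp_all add: algebra_simps)

lemma outer_basis [simp]:
  "outer (basis a) (basis (x, y)) 1 = basis (a @ x, y)"
  "outer 1 (basis (x, y)) (basis c) = basis (x, y @ c)"
  by (simp_all add: outer_def basis_Nil[symmetric] basis_mult plus_list_def)

lemma tensor_entry_outer_left:
  "tensor_entry (outer (basis a) t 1) u l k v = (\<Sum>m\<in>UNIV. word_matrix a $ u $ m * tensor_entry t m l k v)"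
proof (rule clinear_eq[OF clinear_compose[OF tensor_entry_linear outer_linear]])
  show "clinear (\<lambda>t. \<Sum>m\<in>UNIV. word_matrix a $ u $ m * tensor_entry t m l k v)"
    by (intro sum_linear mult_linear_left tensor_entry_linear)
  fix xy :: "'a list \<times> 'a list"
  obtain x y where "xy = (x, y)" by fastforce
  then show "tensor_entry (outer (basis a) (basis xy) 1) u l k v =
     (\<Sum>m\<in>UNIV. word_matrix a $ u $ m * tensor_entry (basis xy) m l k v)"
    by (simp add: tensor_entry_def word_matrix_append)
       (simp add: matrix_matrix_mult_def sum_distrib_right mult.assoc)
qed

lemma tensor_entry_outer_right:
  "tensor_entry (outer 1 t (basis c)) u l k v = (\<Sum>m\<in>UNIV. tensor_entry t u l k m * word_matrix c $ m $ v)"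
proof (rule clinear_eq[OF clinear_compose[OF tensor_entry_linear outer_linear]])
  show "clinear (\<lambda>t. \<Sum>m\<in>UNIV. tensor_entry t u l k m * word_matrix c $ m $ v)"
    by (intro sum_linear mult_linear_right tensor_entry_linear)
  fix xy :: "'a list \<times> 'a list"
  obtain x y where "xy = (x, y)" by fastforce
  then show "tensor_entry (outer 1 (basis xy) (basis c)) u l k v =
     (\<Sum>m\<in>UNIV. tensor_entry (basis xy) u l k m * word_matrix c $ m $ v)"
    by (simp add: tensor_entry_def word_matrix_append)
       (simp add: matrix_matrix_mult_def sum_distrib_left mult.assoc)
qed

lemma eval_generic_mu: "eval_generic (mu t) $ u $ v = (\<Sum>k\<in>UNIV. tensor_entry t u k k v)"
proof -
  have "clinear (\<lambda>t. eval_generic (mu t) $ u $ v)"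
    by (rule clinearI) (simp_all add: mu_simps eval_generic_simps)
  moreover have "clinear (\<lambda>t. \<Sum>k\<in>UNIV. tensor_entry t u k k v)"
    by (intro sum_linear tensor_entry_linear)
  moreover have "eval_generic (mu (basis xy)) $ u $ v = (\<Sum>k\<in>UNIV. tensor_entry (basis xy) u k k v)" for xy
    by (cases xy) (simp add: tensor_entry_def word_matrix_append, simp add: matrix_matrix_mult_def)
  ultimately show ?thesis by (rule clinear_eq)
qed

lemma generic_matrix_entry: "generic_matrix i $ k $ l = basis (Poly_Mapping.single (i, k, l) 1)"
  by (simp add: generic_matrix_def basis_def)

locale double_bracket =
  fixes D :: "'d::finite free_alg2 \<Rightarrow> 'd free_alg2"
  assumes dpb: "double_poisson_bracket D"
begin

lemma D_linear: "clinear D"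
  and D_antisym: "D (tensor a b) = - opposite (D (tensor b a))"
  and D_leibniz: "D (tensor a (b * c)) = outer b (D (tensor a c)) 1 + outer 1 (D (tensor a b)) c"
  and D_jacobi: "bracket_left D a (D (tensor b c)) + sigma (bracket_left D b (D (tensor c a)))
           + sigma_inv (bracket_left D c (D (tensor a b))) = 0"
  by (rule dpb[unfolded double_poisson_bracket_def, THEN conjunct1]
        dpb[unfolded double_poisson_bracket_def, THEN conjunct2, THEN conjunct1, rule_format]
        dpb[unfolded double_poisson_bracket_def, THEN conjunct2, THEN conjunct2, THEN conjunct1, rule_format]
        dpb[unfolded double_poisson_bracket_def, THEN conjunct2, THEN conjunct2, THEN conjunct2, rule_format])+

lemmas D_simps = clinear_simps[OF D_linear]

text \<open>
  The bracket of the coordinate functions on the representation space,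
  \<open>{a\<^sub>k\<^sub>l, b\<^sub>u\<^sub>v} = D(a, b)'\<^sub>u\<^sub>l D(a, b)''\<^sub>k\<^sub>v\<close> (Van den Bergh), prescribed on generators.
\<close>

definition structure_function ::
    "'d \<times> 'n \<times> 'n \<Rightarrow> 'd \<times> 'n \<times> 'n \<Rightarrow> ('d, 'n::finite) coord_ring"
  where "structure_function = (\<lambda>(i, k, l) (j, u, v). tensor_entry (D (basis ([i], [j]))) u l k v)"

abbreviation cb :: "('d, 'n::finite) coord_ring \<Rightarrow> ('d, 'n) coord_ring \<Rightarrow> ('d, 'n) coord_ring"
  where "cb \<equiv> coord_bracket structure_function"

lemma structure_function_antisym: "structure_function s t = - structure_function t s"
  using D_antisym[of "basis [fst s]" "basis [fst t]"]
  by (cases s; cases t) (simp add: structure_function_def tensor_entry_simps tensor_entry_opposite)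

lemmas cb_antisym = coord_bracket_antisym[OF structure_function_antisym]

text \<open>The Leibniz rule of \<open>D\<close> is postulated for the second argument; exchanging
  the arguments lets the first one be treated by the same induction.\<close>

lemma word_bracket_swap:
  assumes "\<And>k l u v :: 'n::finite. cb (word_matrix w $ k $ l) (word_matrix w' $ u $ v) = tensor_entry (D (basis (w, w'))) u l k v"
  shows "cb (word_matrix w' $ k $ l) (word_matrix w $ u $ v) = tensor_entry (D (basis (w', w))) u l k (v :: 'n)"
  using D_antisym[of "basis w'" "basis w"]
  by (subst cb_antisym) (simp add: assms tensor_entry_simps tensor_entry_opposite)

lemma D_one [simp]: "D (tensor a 1) = 0"
proof -
  have "tensor 1 1 = (1 :: 'd free_alg2)"
    using tensor_basis[of "[] :: 'd list" "[] :: 'd list"]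
    by (simp only: basis_Nil) (simp add: one_basis zero_prod_def zero_list_def)
  then have "outer 1 t 1 = t" for t :: "'d free_alg2"
    by (simp add: outer_def)
  then show ?thesis using D_leibniz[of a 1 1] by simp
qed

text \<open>Both sides obey the same Leibniz rule: the outer action affects only the row index
  \<open>u\<close> of the first tensor factor and the column index \<open>v\<close> of the second,
  as matrix multiplication does with the entry at \<open>u\<close>, \<open>v\<close>.\<close>

lemma word_bracket_induct:
  fixes w :: "'d list"
  assumes "\<And>j. \<And>k l u v :: 'n::finite. cb (word_matrix w $ k $ l) (word_matrix [j] $ u $ v) = tensor_entry (D (basis (w, [j]))) u l k v"
  shows "cb (word_matrix w $ k $ l) (word_matrix w' $ u $ v) = tensor_entry (D (basis (w, w'))) u l k (v :: 'n)"
proof (induction w' arbitrary: u v)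
  case Nil
  have "word_matrix [] $ u $ v = (if u = v then 1 else 0 :: ('d, 'n) coord_ring)" by (simp add: mat_def)
  moreover have "D (basis (w, [])) = 0" using D_one[of "basis w"] by (simp add: basis_Nil[symmetric])
  ultimately show ?case by (simp add: tensor_entry_simps coord_bracket_simps)
next
  case (Cons j w')
  have "D (basis (w, j # w')) = outer (basis [j]) (D (basis (w, w'))) 1 + outer 1 (D (basis (w, [j]))) (basis w')"
    using D_leibniz[of "basis w" "basis [j]" "basis w'"] by (simp add: basis_mult plus_list_def)
  moreover have "word_matrix (j # w') $ u $ v =
      (\<Sum>m\<in>UNIV. word_matrix [j] $ u $ m * word_matrix w' $ m $ v :: ('d, 'n) coord_ring)"
    by (simp add: matrix_matrix_mult_def[of _ "word_matrix w'"])
  ultimately show ?case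
    by (simp add: tensor_entry_simps tensor_entry_outer_left tensor_entry_outer_right
       coord_bracket_sum_right coord_bracket_mult_right Cons.IH assms sum.distrib del: word_matrix.simps)
qed

lemma word_bracket:
  "cb (word_matrix w $ k $ l) (word_matrix w' $ u $ v) = tensor_entry (D (basis (w, w'))) u l k (v :: 'n::finite)"
proof -
  have letters: "cb (word_matrix [i] $ k $ l) (word_matrix [j] $ u $ v) =
      tensor_entry (D (basis ([i], [j]))) u l k (v :: 'n)" for i j k l u v
    unfolding word_matrix.simps matrix_mul_rid generic_matrix_entry coord_bracket_vars
    by (simp add: structure_function_def)
  show ?thesis
    \<comment> \<open>Read backwards: letters against letters, letters against words, words against
      letters, words against words.\<close>
    by (rule word_bracket_induct, rule word_bracket_swap, rule word_bracket_induct, rule letters)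
qed

lemma eval_bracket:
  "cb (eval_generic a $ k $ l) (eval_generic b $ u $ v) = tensor_entry (D (tensor a b)) u l k (v :: 'n::finite)"
proof (induction a rule: basis_induct)
  case (basis w)
  show ?case
    by (induction b rule: basis_induct)
       (simp_all add: word_bracket eval_generic_simps coord_bracket_simps tensor_simps D_simps tensor_entry_simps)
qed (simp_all add: eval_generic_simps coord_bracket_simps tensor_simps D_simps tensor_entry_simps)

text \<open>Setting \<open>k = l\<close> and summing closes the inner indices of Van den Bergh's
  formula, which multiplies the two tensor factors.\<close>

lemma trace_bracket:
  fixes u v :: "'n::finite"
  shows "cb (trace (eval_generic a :: ('d, 'n) gmatrix)) (eval_generic b $ u $ v) = eval_generic (bracket_L D a b) $ u $ v"
  by (simp add: trace_def coord_bracket_sum_left eval_bracket bracket_L_def eval_generic_mu)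

lemma trace_trace_bracket:
  "cb (trace (eval_generic a)) (trace (eval_generic b)) = trace (eval_generic (bracket_L D a b) :: ('d, 'n::finite) gmatrix)"
  unfolding trace_def[of "eval_generic b"] trace_def[of "eval_generic (bracket_L D a b)"]
  by (simp add: coord_bracket_sum_right trace_bracket)

end

section \<open>The Jacobi identity for traces\<close>

definition trace3 :: "'d free_alg3 \<Rightarrow> ('d, 'n::finite) coord_ring"
  where "trace3 = lin_extend (\<lambda>((x, y), z). trace (word_matrix (x @ y @ z) :: ('d, 'n) gmatrix))"

lemma trace3_linear: "clinear trace3"
  unfolding trace3_def by (rule lin_extend_linear)

lemma sigma_linear: "clinear sigma" "clinear sigma_inv"
  unfolding sigma_def sigma_inv_def by (rule lin_extend_linear)+

lemma trace_rotate: "trace (word_matrix (x @ y) :: ('d, 'n::finite) gmatrix) = trace (word_matrix (y @ x))"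
  unfolding word_matrix_append by (rule trace_mul_sym)

lemma trace3_sigma: "trace3 (sigma t) = trace3 t" "trace3 (sigma_inv t) = trace3 t"
proof -
  have "trace3 (sigma (basis k)) = trace3 (basis k) \<and> trace3 (sigma_inv (basis k)) = trace3 (basis k)" for k
  proof -
    obtain x y z where "k = ((x, y), z)" by (metis prod.exhaust)
    then show ?thesis
      by (simp add: trace3_def sigma_def sigma_inv_def trace_rotate[of z "x @ y", simplified]
          trace_rotate[of "y @ z" x, simplified])
  qed
  then have "trace3 (sigma (basis k)) = trace3 (basis k)" "trace3 (sigma_inv (basis k)) = trace3 (basis k)" for k
    by blast+
  note * = this
  show "trace3 (sigma t) = trace3 t"
    by (rule clinear_eq[OF clinear_compose[OF trace3_linear sigma_linear(1)] trace3_linear *(1)])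
  show "trace3 (sigma_inv t) = trace3 t"
    by (rule clinear_eq[OF clinear_compose[OF trace3_linear sigma_linear(2)] trace3_linear *(2)])
qed

lemma trace_gmatrix_scale: "trace (gmatrix_scale c M) = cscale c (trace M)"
  unfolding trace_def cvs.scale_sum_right by simp

lemma trace_eval_linear:
  assumes "clinear F"
  shows "clinear (\<lambda>a. trace (eval_generic (F a)))"
proof (rule clinearI)
  fix p q c
  show "trace (eval_generic (F (p + q))) = trace (eval_generic (F p)) + trace (eval_generic (F q))"
    by (simp only: clinear_simps(1)[OF assms] eval_generic_simps(1) trace_add)
  show "trace (eval_generic (F (cscale c p))) = cscale c (trace (eval_generic (F p)))"
    by (simp only: clinear_simps(2)[OF assms] eval_generic_simps(2) trace_gmatrix_scale)
qed

text \<open>The third leg may stand after or before the other two by cyclicity. Both forms occur,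
  since the Leibniz rule for a product puts one factor on the right and the other on the
  left.\<close>

lemma trace3_tensor_basis:
  "trace3 (tensor s (basis y)) = trace (eval_generic (mu (outer 1 s (basis y))))"
  "trace3 (tensor s (basis y)) = trace (eval_generic (mu (outer (basis y) s 1)))"
proof -
  have L: "clinear (\<lambda>s. trace3 (tensor s (basis y)))"
    by (intro clinear_compose[OF trace3_linear] tensor_linear_left)
  have R: "clinear (\<lambda>s. trace (eval_generic (mu (outer a s c))))" for a c
    by (intro trace_eval_linear clinear_compose[OF mu_linear] outer_linear)
  show "trace3 (tensor s (basis y)) = trace (eval_generic (mu (outer 1 s (basis y))))"
    by (rule clinear_eq[OF L R]) (auto simp: trace3_def split: prod.split)
  show "trace3 (tensor s (basis y)) = trace (eval_generic (mu (outer (basis y) s 1)))"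
  proof (rule clinear_eq[OF L R])
    fix k :: "'a list \<times> 'a list"
    show "trace3 (tensor (basis k) (basis y)) = trace (eval_generic (mu (outer (basis y) (basis k) 1)))"
    proof (cases k)
      case (Pair a b)
      then show ?thesis by (simp add: trace3_def trace_rotate[of y "a @ b", simplified])
    qed
  qed
qed

context double_bracket
begin

text \<open>For \<open>t\<close> the tensor of \<open>x\<close> and \<open>y\<close>, the Leibniz
  rule splits the bracket of \<open>a\<close> with \<open>x @ y\<close> in two: the term with
  \<open>D\<close> applied to \<open>x\<close> comes from \<open>t\<close>, the one with
  \<open>D\<close> applied to \<open>y\<close> from the opposite of \<open>t\<close>.\<close>

lemma trace_bracket_mu:
  "trace (eval_generic (bracket_L D a (mu t))) =
    trace3 (bracket_left D a t) + trace3 (bracket_left D a (opposite t))"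
proof -
  have "clinear (\<lambda>t. bracket_L D a (mu t))"
    by (rule clinearI) (simp_all add: bracket_L_def mu_simps tensor_simps D_simps)
  note L = trace_eval_linear[OF this]
  have B: "clinear (bracket_left D a)"
    unfolding bracket_left_def by (rule lin_extend_linear)
  have R: "clinear (\<lambda>t. trace3 (bracket_left D a t) + trace3 (bracket_left D a (opposite t)))"
    by (rule clinearI)
      (simp_all add: clinear_simps[OF B] clinear_simps[OF trace3_linear] clinear_simps[OF opposite_linear] cscale_add)
  show ?thesis
  proof (rule clinear_eq[OF L R])
    fix k :: "'d list \<times> 'd list"
    obtain x y where k: "k = (x, y)" by fastforce
    have "D (tensor a (basis (x @ y))) = outer (basis x) (D (tensor a (basis y))) 1 + outer 1 (D (tensor a (basis x))) (basis y)"
      using D_leibniz[of a "basis x" "basis y"] by (simp add: basis_mult plus_list_def)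
    then show "trace (eval_generic (bracket_L D a (mu (basis k)))) =
      trace3 (bracket_left D a (basis k)) + trace3 (bracket_left D a (opposite (basis k)))"
      unfolding k
      by (simp add: bracket_L_def bracket_left_def mu_simps eval_generic_simps trace_add trace3_tensor_basis(1)[of _ y]
        trace3_tensor_basis(2)[of _ x])
  qed
qed

text \<open>
  The cyclic sum of \<open>{tr a, {tr b, tr c}}\<close> is the trace of the double Jacobi identity for \<open>(a, b, c)\<close>
  minus the one for \<open>(a, c, b)\<close>.
\<close>

lemma trace_jacobi:
  fixes T :: "'d free_alg \<Rightarrow> ('d, 'n::finite) coord_ring"
  defines "T \<equiv> (\<lambda>a. trace (eval_generic a))"
  shows "cb (T a) (cb (T b) (T c)) + cb (T b) (cb (T c) (T a)) + cb (T c) (cb (T a) (T b)) = 0"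
proof -
  define g :: "'d free_alg \<Rightarrow> 'd free_alg \<Rightarrow> 'd free_alg \<Rightarrow> ('d, 'n) coord_ring"
    where "g a b c = trace3 (bracket_left D a (D (tensor b c)))" for a b c
  have B: "clinear (bracket_left D a)" for a
    unfolding bracket_left_def by (rule lin_extend_linear)
  have *: "cb (T a) (cb (T b) (T c)) = g a b c - g a c b" for a b c
  proof -
    have "opposite (D (tensor b c)) = - D (tensor c b)"
      using D_antisym[of c b] by simp
    then show ?thesis
      using trace_bracket_mu[of a "D (tensor b c)"]
      by (simp add: T_def trace_trace_bracket g_def bracket_L_def[of D b] clinear_simps[OF B] clinear_simps[OF trace3_linear])
  qed
  have **: "g a b c + g b c a + g c a b = 0" for a b c
    using arg_cong[OF D_jacobi[of a b c], of "trace3 :: _ \<Rightarrow> ('d, 'n) coord_ring"]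
    by (simp add: clinear_simps[OF trace3_linear] trace3_sigma g_def)
  have "(g a b c - g a c b) + (g b c a - g b a c) + (g c a b - g c b a) =
      (g a b c + g b c a + g c a b) - (g a c b + g c b a + g b a c)" by (simp add: algebra_simps)
  then show ?thesis by (simp only: * **) simp
qed

end

section \<open>Scalar matrices\<close>

lemma gmatrix_scale_simps:
  shows "gmatrix_scale c (A + B) = gmatrix_scale c A + gmatrix_scale c B"
    "gmatrix_scale (c + d) A = gmatrix_scale c A + gmatrix_scale d A"
    "gmatrix_scale c (gmatrix_scale d A) = gmatrix_scale (c * d) A"
    "gmatrix_scale 1 A = A"
    "gmatrix_scale c A ** B = gmatrix_scale c (A ** B)"
    "A ** gmatrix_scale c B = gmatrix_scale c (A ** B)"
    "gmatrix_scale c (mat f) = mat (cscale c f)"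
  by (simp_all add: vec_eq_iff cscale_add cscale_add_left matrix_matrix_mult_def cvs.scale_sum_right mat_def)

interpretation gvs: vector_space "gmatrix_scale :: complex \<Rightarrow> ('d, 'n::finite) gmatrix \<Rightarrow> _"
  by unfold_locales (rule gmatrix_scale_simps)+

lemma mat_add: "mat (f + g) = mat f + mat g" for f g :: "'a::comm_monoid_add"
  by (simp add: vec_eq_iff mat_def)

lemma matrix_add_rdistrib: "(A + B) ** C = A ** C + B ** C" for A B :: "'a::semiring_1^'n::finite^'m"
  by (simp add: vec_eq_iff matrix_matrix_mult_def distrib_right sum.distrib)

lemma mat_mult: "mat (f * g) = mat f ** mat g" for f g :: "'a::comm_ring_1"
  by (simp add: vec_eq_iff) (simp add: mat_def)

lemma mat_eq_iff: "(mat f :: 'a::zero^'n^'n) = mat g \<longleftrightarrow> f = g"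
  by (auto simp: vec_eq_iff mat_def)

lemma matrix_mult_mat_left:
  fixes A B :: "'a::comm_ring_1^'n::finite^'n"
  shows "A ** (mat g ** B) = mat g ** (A ** B)"
  by (metis mat_central matrix_mul_assoc)

lemma trace_mat: "trace (mat f :: 'a::comm_ring_1^'n^'n) = of_nat CARD('n) * f"
  by (simp add: trace_def mat_def)

lemma cscale_of_nat: "cscale (of_nat k) p = of_nat k * p" for p :: "'k::monoid_add \<Rightarrow>\<^sub>0 complex"
  by (induction k) (simp_all add: cscale_add_left distrib_right)

section \<open>Gradings\<close>

text \<open>Variable weights allow two gradings: by total degree for the Nakayama argument, and by
  degree in the diagonal variables of one generic matrix for the center.\<close>

definition weight :: "('v::finite \<Rightarrow> nat) \<Rightarrow> ('v \<Rightarrow>\<^sub>0 nat) \<Rightarrow> nat"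
  where "weight \<omega> x = (\<Sum>s\<in>UNIV. \<omega> s * Poly_Mapping.lookup x s)"

definition component :: "('v::finite \<Rightarrow> nat) \<Rightarrow> nat \<Rightarrow> (('v \<Rightarrow>\<^sub>0 nat) \<Rightarrow>\<^sub>0 complex) \<Rightarrow> (('v \<Rightarrow>\<^sub>0 nat) \<Rightarrow>\<^sub>0 complex)"
  where "component \<omega> m = lin_extend (\<lambda>x. if weight \<omega> x = m then basis x else 0)"

definition homogeneous :: "('v::finite \<Rightarrow> nat) \<Rightarrow> nat \<Rightarrow> (('v \<Rightarrow>\<^sub>0 nat) \<Rightarrow>\<^sub>0 complex) \<Rightarrow> bool"
  where "homogeneous \<omega> e f \<longleftrightarrow> (\<forall>x\<in>Poly_Mapping.keys f. weight \<omega> x = e)"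

lemma component_linear: "clinear (component \<omega> m)"
  unfolding component_def by (rule lin_extend_linear)

lemmas component_simps = clinear_simps[OF component_linear]
lemmas component_sum = clinear_sum[OF component_linear]

lemma weight_add: "weight \<omega> (x + y) = weight \<omega> x + weight \<omega> y"
  by (simp add: weight_def lookup_add distrib_left sum.distrib)

lemma weight_single: "weight \<omega> (Poly_Mapping.single s n) = \<omega> s * n"
  by (simp add: weight_def lookup_single when_def if_distrib[of "\<lambda>x. _ * x"] cong: if_cong)

lemma lookup_component: "Poly_Mapping.lookup (component \<omega> m f) x = (if weight \<omega> x = m then Poly_Mapping.lookup f x else 0)"
proof (induction f rule: basis_induct)
  case (basis k)
  have "component \<omega> m (basis k) = (if weight \<omega> k = m then basis k else 0)"
    by (simp add: component_def)
  then show ?case by (auto simp: basis_def lookup_single when_def)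
qed (simp_all add: component_simps lookup_add)

lemma component_homogeneous:
  assumes "homogeneous \<omega> e f"
  shows "component \<omega> m f = (if m = e then f else 0)"
  using assms by (intro poly_mapping_eqI) (auto simp: lookup_component homogeneous_def in_keys_iff)

lemma homogeneous_zero: "homogeneous \<omega> e 0"
  by (simp add: homogeneous_def)

lemma homogeneous_basis: "weight \<omega> x = e \<Longrightarrow> homogeneous \<omega> e (basis x)"
  by (simp add: homogeneous_def basis_def)

lemma homogeneous_add: "homogeneous \<omega> e f \<Longrightarrow> homogeneous \<omega> e g \<Longrightarrow> homogeneous \<omega> e (f + g)"
  using keys_add[of f g] by (auto simp: homogeneous_def)

lemma homogeneous_sum: "(\<And>i. i \<in> A \<Longrightarrow> homogeneous \<omega> e (f i)) \<Longrightarrow> homogeneous \<omega> e (sum f A)"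
  by (induction A rule: infinite_finite_induct) (auto simp: homogeneous_zero intro: homogeneous_add)

lemma homogeneous_mult: "homogeneous \<omega> e f \<Longrightarrow> homogeneous \<omega> e' g \<Longrightarrow> homogeneous \<omega> (e + e') (f * g)"
  using keys_mult[of f g] by (fastforce simp: homogeneous_def weight_add)

lemma homogeneous_one: "homogeneous \<omega> 0 1"
  by (simp add: homogeneous_def weight_def)

lemma homogeneous_word:
  "homogeneous (\<lambda>_. Suc 0) (length w) (word_matrix w $ k $ l :: ('d::finite, 'n::finite) coord_ring)"
proof (induction w arbitrary: k)
  case Nil
  then show ?case by (simp add: mat_def homogeneous_one homogeneous_zero)
next
  case (Cons i w)
  have "homogeneous (\<lambda>_. Suc 0) 1 (generic_matrix i $ k $ m :: ('d, 'n) coord_ring)" for m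
    unfolding generic_matrix_entry by (rule homogeneous_basis) (simp add: weight_single)
  then have "homogeneous (\<lambda>_. Suc 0) (1 + length w)
      (\<Sum>m\<in>UNIV. generic_matrix i $ k $ m * word_matrix w $ m $ l :: ('d, 'n) coord_ring)"
    by (intro homogeneous_sum homogeneous_mult Cons)
  then show ?case
    by (simp add: matrix_matrix_mult_def)
qed

section \<open>Products of traces\<close>

text \<open>The empty word is excluded because its trace is the constant n. Thus \<open>e\<close> is
  positive exactly when at least one trace factor occurs.\<close>

inductive trace_product :: "nat \<Rightarrow> ('d::finite, 'n::finite) coord_ring \<Rightarrow> bool" where
  one: "trace_product 0 1"
| trace: "trace_product e f \<Longrightarrow> w \<noteq> [] \<Longrightarrow>
    trace_product (length w + e) (trace (word_matrix w :: ('d, 'n) gmatrix) * f)"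

lemma trace_product_mult: "trace_product e f \<Longrightarrow> trace_product e' g \<Longrightarrow> trace_product (e + e') (f * g)"
  by (induction rule: trace_product.induct)
    (auto simp: mult.assoc add.assoc intro: trace_product.trace)

lemma trace_product_trace: "w \<noteq> [] \<Longrightarrow> trace_product (length w) (trace (word_matrix w :: ('d::finite, 'n::finite) gmatrix))"
  using trace_product.trace[OF trace_product.one, of w] by simp

lemma trace_product_homogeneous: "trace_product e f \<Longrightarrow> homogeneous (\<lambda>_. Suc 0) e f"
  by (induction rule: trace_product.induct)
    (auto simp: trace_def intro!: homogeneous_one homogeneous_mult homogeneous_sum homogeneous_word[simplified])

text \<open>The predicate on trace degree and word lets one definition cover the whole trace ring,
  Z_+ T, the part of positive total degree, and the span of short words over the traces.\<close>

definition trace_span :: "(nat \<Rightarrow> 'd list \<Rightarrow> bool) \<Rightarrow> ('d::finite, 'n::finite) gmatrix set"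
  where "trace_span Q = gvs.span {mat f ** word_matrix w | e f w. trace_product e f \<and> Q e w}"

lemma trace_span_base: "trace_product e f \<Longrightarrow> Q e w \<Longrightarrow> mat f ** word_matrix w \<in> trace_span Q"
  unfolding trace_span_def by (rule gvs.span_base) auto

lemma trace_span_simps:
  shows trace_span_zero: "0 \<in> trace_span Q"
    and trace_span_add: "A \<in> trace_span Q \<Longrightarrow> B \<in> trace_span Q \<Longrightarrow> A + B \<in> trace_span Q"
    and trace_span_diff: "A \<in> trace_span Q \<Longrightarrow> B \<in> trace_span Q \<Longrightarrow> A - B \<in> trace_span Q"
    and trace_span_scale: "A \<in> trace_span Q \<Longrightarrow> gmatrix_scale c A \<in> trace_span Q"
  unfolding trace_span_def by (rule gvs.span_zero gvs.span_add gvs.span_diff gvs.span_scale; assumption)+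

lemma trace_span_subspace: "gvs.subspace (trace_span Q)"
  unfolding trace_span_def by (rule gvs.subspace_span)

lemma trace_span_induct:
  assumes "A \<in> trace_span Q" "gvs.subspace {A. P A}"
    "\<And>e f w. trace_product e f \<Longrightarrow> Q e w \<Longrightarrow> P (mat f ** word_matrix w)"
  shows "P A"
  using assms(1) unfolding trace_span_def
  by (rule gvs.span_induct) (use assms(2,3) in auto)

lemma trace_span_map:
  assumes "A \<in> trace_span Q" "gvs.subspace V"
    and "\<And>A B. F (A + B) = F A + F B" "\<And>c A. F (gmatrix_scale c A) = gmatrix_scale c (F A)"
    and "\<And>e f w. trace_product e f \<Longrightarrow> Q e w \<Longrightarrow> F (mat f ** word_matrix w) \<in> V"
  shows "F A \<in> V"
proof (rule trace_span_induct[OF assms(1)])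
  have "F 0 = 0" using assms(3)[of 0 0] by simp
  then show "gvs.subspace {A. F A \<in> V}"
    using assms(2) by (auto simp: gvs.subspace_def assms(3,4))
qed (rule assms(5))

lemma trace_span_mono: "A \<in> trace_span Q \<Longrightarrow> (\<And>e w. Q e w \<Longrightarrow> Q' e w) \<Longrightarrow> A \<in> trace_span Q'"
  by (rule trace_span_map[of A Q _ "\<lambda>A. A", OF _ trace_span_subspace]) (auto intro: trace_span_base)

lemma trace_span_mat_mult:
  fixes A :: "('d::finite, 'n::finite) gmatrix"
  assumes "A \<in> trace_span Q" "trace_product e f" "\<And>e' w. Q e' w \<Longrightarrow> Q' (e + e') w"
  shows "mat f ** A \<in> trace_span Q'"
proof (rule trace_span_map[OF assms(1) trace_span_subspace])
  fix e' and g :: "('d, 'n) coord_ring" and w :: "'d list" assume *: "trace_product e' g" "Q e' w"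
  then show "mat f ** (mat g ** word_matrix w) \<in> trace_span Q'"
    using trace_span_base[of "e + e'" "f * g" Q' w] trace_product_mult[OF assms(2) *(1)] assms(3)
    by (simp add: matrix_mul_assoc mat_mult)
qed (simp_all add: matrix_add_ldistrib gmatrix_scale_simps)

lemma trace_span_word_mult:
  fixes A :: "('d::finite, 'n::finite) gmatrix"
  assumes "A \<in> trace_span Q"
  shows "(\<And>e w. Q e w \<Longrightarrow> Q' e (w @ v)) \<Longrightarrow> A ** word_matrix v \<in> trace_span Q'"
    and "(\<And>e w. Q e w \<Longrightarrow> Q' e (v @ w)) \<Longrightarrow> word_matrix v ** A \<in> trace_span Q'"
proof -
  assume Q: "\<And>e w. Q e w \<Longrightarrow> Q' e (w @ v)"
  show "A ** word_matrix v \<in> trace_span Q'"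
  proof (rule trace_span_map[OF assms trace_span_subspace])
    fix e and f :: "('d, 'n) coord_ring" and w :: "'d list" assume "trace_product e f" "Q e w"
    then show "mat f ** word_matrix w ** word_matrix v \<in> trace_span Q'"
      using trace_span_base[of e f Q' "w @ v"] Q by (simp add: word_matrix_append matrix_mul_assoc)
  qed (simp_all add: matrix_add_rdistrib gmatrix_scale_simps)
next
  assume Q: "\<And>e w. Q e w \<Longrightarrow> Q' e (v @ w)"
  show "word_matrix v ** A \<in> trace_span Q'"
  proof (rule trace_span_map[OF assms trace_span_subspace])
    fix e and f :: "('d, 'n) coord_ring" and w :: "'d list" assume "trace_product e f" "Q e w"
    then show "word_matrix v ** (mat f ** word_matrix w) \<in> trace_span Q'"
      using trace_span_base[of e f Q' "v @ w"] Q by (simp add: word_matrix_append matrix_mult_mat_left)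
  qed (simp_all add: matrix_add_ldistrib gmatrix_scale_simps)
qed

lemma trace_span_eval_mult:
  assumes "A \<in> trace_span Q" "\<And>e v w. Q e w \<Longrightarrow> Q e (v @ w)" "\<And>e v w. Q e w \<Longrightarrow> Q e (w @ v)"
  shows "A ** eval_generic a \<in> trace_span Q" "eval_generic a ** A \<in> trace_span Q"
  by (induction a rule: basis_induct)
    (auto simp: eval_generic_simps gmatrix_scale_simps matrix_add_ldistrib matrix_add_rdistrib
      intro: trace_span_add trace_span_scale trace_span_word_mult[OF assms(1)] assms(2,3))

lemma eval_generic_mult: "eval_generic (a * b) = eval_generic a ** eval_generic b"
proof (induction a rule: basis_induct)
  case (basis v)
  show ?case
  proof (induction b rule: basis_induct)
    case (basis w)
    show ?case by (simp add: basis_mult plus_list_def word_matrix_append)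
  qed (simp_all add: distrib_left eval_generic_simps matrix_add_ldistrib gmatrix_scale_simps)
qed (simp_all add: distrib_right eval_generic_simps matrix_add_rdistrib gmatrix_scale_simps)

lemma eval_generic_one: "eval_generic 1 = mat 1"
  by (simp add: basis_Nil[symmetric])

section \<open>The augmentation ideal\<close>

definition aug_ideal :: "'d free_alg set"
  where "aug_ideal = {a. Poly_Mapping.lookup a [] = 0}"

lemma lookup_mult_Nil: "Poly_Mapping.lookup (a * b) [] = Poly_Mapping.lookup a [] * Poly_Mapping.lookup b []"
  for a b :: "'d free_alg"
proof (induction a rule: basis_induct)
  case (basis v)
  show ?case
  proof (induction b rule: basis_induct)
    case (basis w)
    show ?case by (simp add: basis_mult plus_list_def) (auto simp: basis_def lookup_single when_def)
  qed (simp_all add: distrib_left lookup_add)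
qed (simp_all add: distrib_right lookup_add)

lemma aug_ideal_ideal: "ideal_of_ring aug_ideal"
  by (simp add: ideal_of_ring_def aug_ideal_def lookup_add lookup_mult_Nil)

lemma eval_aug_ideal:
  assumes "a \<in> aug_ideal"
  shows "eval_generic a \<in> trace_span (\<lambda>e w. e + length w > 0)"
proof -
  have "gmatrix_scale (Poly_Mapping.lookup a w) (word_matrix w) \<in> trace_span (\<lambda>e w. e + length w > 0)"
    if "w \<in> Poly_Mapping.keys a" for w
  proof -
    have "w \<noteq> []" using that assms by (auto simp: aug_ideal_def in_keys_iff)
    then have "mat 1 ** word_matrix w \<in> trace_span (\<lambda>e w. e + length w > 0)"
      by (intro trace_span_base[OF trace_product.one]) simp
    then show ?thesis by (intro trace_span_scale) simp
  qed
  then show ?thesis unfolding eval_generic_def trace_span_def by (rule gvs.span_sum)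
qed

section \<open>Powers and long words modulo traces of positive degree\<close>

abbreviation pos_span :: "('d::finite, 'n::finite) gmatrix set"
  where "pos_span \<equiv> trace_span (\<lambda>e w. e > 0)"

text \<open>Taking the trace moves the degree of the word into the trace factor; for the empty word
  that factor has positive degree already.\<close>

lemma trace_pos_span:
  assumes "A \<in> trace_span (\<lambda>e w. e + length w > 0)"
  shows "mat (trace A) \<in> pos_span"
proof (rule trace_span_map[OF assms trace_span_subspace, of "\<lambda>A. mat (trace A)"])
  fix e and f :: "('a, 'b) coord_ring" and w :: "'a list"
  assume e: "trace_product e f" "e + length w > 0"
  show "mat (trace (mat f ** word_matrix w)) \<in> pos_span"
  proof (cases w)
    case Nil
    have "mat f \<in> (pos_span :: ('a, 'b) gmatrix set)"
      using trace_span_base[OF e(1), of "\<lambda>e w. e > 0" "[]"] e(2) Nil by simp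
    from trace_span_scale[OF this, of "of_nat CARD('b)"] show ?thesis
      by (simp add: Nil trace_I gmatrix_scale_simps cscale_of_nat mult.commute trace_mat)
  next
    case (Cons i v)
    then have "trace_product (e + length w) (f * trace (word_matrix w :: ('a, 'b) gmatrix))"
      by (intro trace_product_mult e trace_product_trace) simp
    from trace_span_base[OF this, of "\<lambda>e w. e > 0" "[]"] e show ?thesis by simp
  qed
qed (simp_all add: trace_add mat_add trace_gmatrix_scale gmatrix_scale_simps)

text \<open>The trace term of the recursion is the trace of something of positive degree, so it
  vanishes modulo Z_+ T. What remains is multiplication by \<open>x\<close> and by
  \<open>- Suc k\<close>, so the constant is (-1)^k k!, of which only being nonzero is
  recorded.\<close>

lemma leverrier_eval:
  fixes x :: "'d::finite free_alg"
  assumes "x \<in> aug_ideal"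
  shows "\<exists>c. c \<noteq> 0 \<and> leverrier (eval_generic x) k - gmatrix_scale c (eval_generic (x ^ k)) \<in>
    (pos_span :: ('d, 'n::finite) gmatrix set)"
proof (induction k)
  case 0
  then show ?case by (intro exI[of _ 1]) (simp add: gmatrix_scale_simps eval_generic_one trace_span_zero)
next
  case (Suc k)
  let ?M = "eval_generic x :: ('d, 'n) gmatrix" let ?L = "leverrier ?M k"
  from Suc obtain c where c: "c \<noteq> 0" and V: "?L - gmatrix_scale c (eval_generic (x ^ k)) \<in> pos_span" (is "?V \<in> _")
    by (elim exE conjE)
  have L: "?L = ?V + gmatrix_scale c (eval_generic (x ^ k))" by simp
  have VM: "?V ** ?M \<in> pos_span" "?M ** ?V \<in> pos_span"
    by (rule trace_span_eval_mult[OF V]; simp)+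
  have "x ^ Suc k \<in> aug_ideal"
    using ideal_rmult[OF aug_ideal_ideal assms] by simp
  then have "eval_generic (x ^ Suc k) \<in> trace_span (\<lambda>e w. e + length w > 0)"
    by (rule eval_aug_ideal)
  moreover have "?M ** ?V \<in> trace_span (\<lambda>e w. e + length w > 0)"
    by (rule trace_span_mono[OF VM(2)]) simp
  ultimately have "?M ** ?V + gmatrix_scale c (eval_generic (x ^ Suc k)) \<in> trace_span (\<lambda>e w. e + length w > 0)"
    by (intro trace_span_add trace_span_scale)
  moreover have "?M ** ?L = ?M ** ?V + gmatrix_scale c (eval_generic (x ^ Suc k))"
    by (subst L) (simp only: matrix_add_ldistrib gmatrix_scale_simps power_Suc eval_generic_mult)
  ultimately have 1: "mat (trace (?M ** ?L)) \<in> pos_span"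
    by (simp only: trace_pos_span)
  let ?k = "of_nat (Suc k) :: complex"
  have scal: "mat (of_nat (Suc k)) ** A = gmatrix_scale ?k A" for A :: "('d, 'n) gmatrix"
    by (simp only: vec_eq_iff mat_mult_entry gmatrix_scale_entry cscale_of_nat simp_thms)
  have "?L ** ?M = ?V ** ?M + gmatrix_scale c (eval_generic (x ^ Suc k))"
    by (subst L) (simp only: matrix_add_rdistrib gmatrix_scale_simps power_Suc2 eval_generic_mult)
  then have "leverrier ?M (Suc k) - gmatrix_scale (- (?k * c)) (eval_generic (x ^ Suc k)) =
      mat (trace (?M ** ?L)) - gmatrix_scale ?k (?V ** ?M)"
    by (simp only: leverrier.simps scal gvs.scale_right_distrib gvs.scale_scale gvs.scale_minus_left) simp
  also have "\<dots> \<in> pos_span" by (intro trace_span_diff trace_span_scale 1 VM)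
  finally have "leverrier ?M (Suc k) - gmatrix_scale (- (?k * c)) (eval_generic (x ^ Suc k)) \<in> pos_span" .
  moreover have "- (?k * c) \<noteq> 0" using c by (simp del: of_nat_Suc)
  ultimately show ?case by blast
qed

lemma power_card_pos_span:
  assumes "x \<in> aug_ideal"
  shows "eval_generic (x ^ CARD('n)) \<in> (pos_span :: ('d::finite, 'n::finite) gmatrix set)"
proof -
  let ?M = "eval_generic x :: ('d, 'n) gmatrix"
  have "p = 0" if "p + p = 0" for p :: "('d, 'n) coord_ring"
  proof (rule poly_mapping_eqI)
    fix k
    from that have "Poly_Mapping.lookup (p + p) k = 0" by simp
    then show "Poly_Mapping.lookup p k = Poly_Mapping.lookup 0 k" by (simp only: lookup_add) simp
  qed
  then have zero: "leverrier ?M CARD('n) = 0" by (rule leverrier_card_eq_0)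
  from leverrier_eval[OF assms, of "CARD('n)"]
  obtain c where "c \<noteq> 0" "leverrier ?M CARD('n) - gmatrix_scale c (eval_generic (x ^ CARD('n))) \<in> pos_span"
    by (elim exE conjE)
  from trace_span_scale[OF this(2), of "- inverse c"] \<open>c \<noteq> 0\<close>
  show ?thesis by (simp add: zero)
qed

text \<open>Nagata-Higman is applied in the free algebra, to the preimage of Z_+ T and the
  augmentation ideal, which contains the letters. Surplus letters are absorbed because the preimage
  is an ideal.\<close>

lemma word_pos_span:
  fixes w :: "'d::finite list"
  assumes "length w \<ge> 2 ^ CARD('n) - 1"
  shows "word_matrix w \<in> (pos_span :: ('d, 'n::finite) gmatrix set)"
proof -
  define J :: "'d free_alg set" where "J = {a. eval_generic a \<in> (pos_span :: ('d, 'n) gmatrix set)}"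
  have J: "ideal_of_ring J"
    unfolding ideal_of_ring_def J_def
    by (auto simp: eval_generic_simps eval_generic_mult intro: trace_span_zero trace_span_add trace_span_eval_mult)
  have inv: "\<exists>r::'d free_alg. r * of_nat k = 1" if "k > 0" for k
  proof -
    have "cscale (inverse (of_nat k)) 1 * of_nat k = cscale (inverse (of_nat k)) (cscale (of_nat k) (1 :: 'd free_alg))"
      unfolding cscale_of_nat by (simp only: cscale_mult_left mult_1_left mult_1_right)
    also have "\<dots> = 1" using that by simp
    finally show ?thesis by blast
  qed
  let ?N = "2 ^ CARD('n) - 1 :: nat"
  have prod: "prod_list (map (\<lambda>i. basis [i]) v) = basis v" for v :: "'d list"
    by (induction v) (simp_all add: basis_Nil basis_mult plus_list_def)
  have "prod_list (map (\<lambda>i. basis [i]) (take ?N w)) \<in> J"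
  proof (rule nagata_higman[OF J aug_ideal_ideal inv])
    show "x ^ CARD('n) \<in> J" if "x \<in> aug_ideal" for x
      using power_card_pos_span[OF that] by (simp add: J_def)
    show "set (map (\<lambda>i. basis [i]) (take ?N w)) \<subseteq> aug_ideal"
      by (auto simp: aug_ideal_def basis_def lookup_single)
    show "length (map (\<lambda>i. basis [i]) (take ?N w)) = ?N" using assms by simp
  qed
  from ideal_rmult[OF J this, of "basis (drop ?N w)"] have "basis w \<in> J"
    by (simp add: prod basis_mult plus_list_def)
  then show ?thesis by (simp add: J_def)
qed

text \<open>Graded Nakayama lemma: by homogeneity, the trace factors of positive degree shorten the word.\<close>

lemma word_short_span:
  fixes w :: "'d::finite list"
  defines "V \<equiv> trace_span (\<lambda>e w. length w < 2 ^ CARD('n)) :: ('d, 'n::finite) gmatrix set"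
  shows "word_matrix w \<in> V"
proof (induction "length w" arbitrary: w rule: less_induct)
  case less
  show ?case
  proof (cases "length w < 2 ^ CARD('n)")
    case True
    then have "mat 1 ** word_matrix w \<in> V" unfolding V_def
      by (intro trace_span_base[OF trace_product.one])
    then show ?thesis by simp
  next
    case False
    let ?m = "length w"
    \<comment> \<open>Membership in \<open>pos_span\<close> gives no control over degrees.
      Projecting the entries to degree \<open>?m\<close> fixes the word matrix and keeps only terms
      whose word has length \<open>?m - e\<close>.\<close>
    define F :: "('d, 'n) gmatrix \<Rightarrow> ('d, 'n) gmatrix"
      where "F A = (\<chi> k l. component (\<lambda>_. Suc 0) ?m (A $ k $ l))" for A
    have F: "F (mat f ** word_matrix v) = (if e + length v = ?m then mat f ** word_matrix v else 0)"
      if "trace_product e f" for e f v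
    proof -
      have "homogeneous (\<lambda>_. Suc 0) (e + length v) (f * word_matrix v $ k $ l)" for k l
        by (intro homogeneous_mult trace_product_homogeneous that homogeneous_word)
      then show ?thesis
        by (simp add: F_def vec_eq_iff component_homogeneous[of _ "e + length v"])
    qed
    have "F (word_matrix w) \<in> V"
    proof (rule trace_span_map[where F = F and Q = "\<lambda>e w. e > 0"])
      show "word_matrix w \<in> (pos_span :: ('d, 'n) gmatrix set)"
        using False by (intro word_pos_span) simp
      show "gvs.subspace V" unfolding V_def by (rule trace_span_subspace)
      show "F (A + B) = F A + F B" "F (gmatrix_scale c A) = gmatrix_scale c (F A)" for A B c
        by (simp_all add: F_def vec_eq_iff component_simps)
      fix e and f :: "('d, 'n) coord_ring" and v :: "'d list" assume ef: "trace_product e f" "e > 0"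
      show "F (mat f ** word_matrix v) \<in> V"
      proof (cases "e + length v = ?m")
        case True
        then have "word_matrix v \<in> V" using ef(2) by (intro less) simp
        then have "mat f ** word_matrix v \<in> V"
          unfolding V_def by (rule trace_span_mat_mult[OF _ ef(1)])
        then show ?thesis using F[OF ef(1)] True by simp
      next
        case False
        then show ?thesis using F[OF ef(1)] by (simp add: V_def trace_span_zero)
      qed
    qed
    moreover have "F (word_matrix w) = word_matrix w"
      using F[OF trace_product.one, of w] by simp
    ultimately show ?thesis by simp
  qed
qed

lemma trace_span_short:
  assumes "A \<in> trace_span (\<lambda>_ _. True)"
  shows "A \<in> (trace_span (\<lambda>e w. length w < 2 ^ CARD('n)) :: ('d::finite, 'n::finite) gmatrix set)"
  by (rule trace_span_map[OF assms trace_span_subspace, of "\<lambda>A. A"])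
     (auto intro: trace_span_mat_mult[OF word_short_span])

section \<open>Subalgebras of the matrix algebra\<close>

definition matrix_subalgebra :: "('d, 'n::finite) gmatrix set \<Rightarrow> bool"
  where "matrix_subalgebra S \<longleftrightarrow> mat 1 \<in> S \<and> (\<forall>A\<in>S. \<forall>B\<in>S. A + B \<in> S \<and> A ** B \<in> S) \<and>
    (\<forall>c. \<forall>A\<in>S. gmatrix_scale c A \<in> S)"

lemma matrix_subalgebraD:
  assumes "matrix_subalgebra S"
  shows "mat 1 \<in> S" "A \<in> S \<Longrightarrow> B \<in> S \<Longrightarrow> A + B \<in> S" "A \<in> S \<Longrightarrow> B \<in> S \<Longrightarrow> A ** B \<in> S"
    "A \<in> S \<Longrightarrow> gmatrix_scale c A \<in> S" "0 \<in> S" "A \<in> S \<Longrightarrow> - A \<in> S"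
proof -
  show 1: "mat 1 \<in> S" "A \<in> S \<Longrightarrow> B \<in> S \<Longrightarrow> A + B \<in> S" "A \<in> S \<Longrightarrow> B \<in> S \<Longrightarrow> A ** B \<in> S"
    and 2: "A \<in> S \<Longrightarrow> gmatrix_scale c A \<in> S" for A B c
    using assms by (auto simp: matrix_subalgebra_def)
  show "0 \<in> S" using 2[OF 1(1), of 0] by simp
  show "A \<in> S \<Longrightarrow> - A \<in> S" using 2[of A "-1"] by simp
qed

lemma matrix_subalgebra_sum:
  assumes "matrix_subalgebra S" "\<And>i. i \<in> I \<Longrightarrow> f i \<in> S"
  shows "sum f I \<in> S"
  using assms(2) by (induction I rule: infinite_finite_induct)
    (auto intro: matrix_subalgebraD[OF assms(1)])

abbreviation subalgebra_record :: "('d, 'n::finite) gmatrix set \<Rightarrow> (complex, ('d, 'n) gmatrix) module"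
  where "subalgebra_record S \<equiv> gmatrix_algebra\<lparr>carrier := S\<rparr>"

lemma gmatrix_algebra_simps [simp]:
  "monoid.mult gmatrix_algebra = (**)" "one gmatrix_algebra = mat 1" "zero gmatrix_algebra = 0"
  "add gmatrix_algebra = (+)" "smult gmatrix_algebra = gmatrix_scale" "carrier gmatrix_algebra = UNIV"
  by (simp_all add: gmatrix_algebra_def)

lemma ring_subalgebra_record:
  assumes "matrix_subalgebra S"
  shows "ring (subalgebra_record S)"
proof (rule ringI)
  note S = matrix_subalgebraD[OF assms]
  show "abelian_group (subalgebra_record S)"
  proof (rule abelian_groupI)
    fix x assume "x \<in> carrier (subalgebra_record S)"
    then show "\<exists>y\<in>carrier (subalgebra_record S). y \<oplus>\<^bsub>subalgebra_record S\<^esub> x = \<zero>\<^bsub>subalgebra_record S\<^esub>"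
      using S(6) by (intro bexI[of _ "- x"]) auto
  qed (auto intro: S simp: add.assoc add.commute)
  show "Group.monoid (subalgebra_record S)"
    by (rule monoidI) (auto intro: S simp: matrix_mul_assoc)
qed (auto simp: matrix_add_rdistrib matrix_add_ldistrib)

lemma a_inv_subalgebra_record:
  assumes "matrix_subalgebra S" "A \<in> S"
  shows "\<ominus>\<^bsub>subalgebra_record S\<^esub> A = - A"
proof -
  interpret ring "subalgebra_record S" by (rule ring_subalgebra_record[OF assms(1)])
  show ?thesis
    using minus_equality[of "- A" A] matrix_subalgebraD(6)[OF assms] assms(2) by simp
qed

lemma complex_algebra_subalgebra_record:
  assumes "matrix_subalgebra S"
  shows "complex_algebra (subalgebra_record S)"
proof -
  interpret R: ring "subalgebra_record S" by (rule ring_subalgebra_record[OF assms])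
  note S = matrix_subalgebraD[OF assms]
  have "module (ring_of_type_algebra :: complex ring) (subalgebra_record S)"
  proof (rule moduleI)
    show "cring (ring_of_type_algebra :: complex ring)" by (rule cring_from_type_algebra)
    show "abelian_group (subalgebra_record S)" by (rule R.abelian_group_axioms)
  qed (auto intro: S simp: ring_of_type_algebra_def gmatrix_scale_simps)
  then show ?thesis
    by (simp add: complex_algebra_def R.ring_axioms gmatrix_scale_simps)
qed

text \<open>Reduces the record predicates to closure conditions on sets of matrices, inside any
  ambient subalgebra; applied to the full matrix algebra and to the trace ring.\<close>

lemma complex_subalgebra_subalgebra_record:
  assumes "matrix_subalgebra S" "S' \<subseteq> S"
  shows "complex_subalgebra S' (subalgebra_record S) \<longleftrightarrow> matrix_subalgebra S'"
proof -
  interpret R: ring "subalgebra_record S" by (rule ring_subalgebra_record[OF assms(1)])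
  show ?thesis
  proof
    assume *: "complex_subalgebra S' (subalgebra_record S)"
    then have "subring S' (subalgebra_record S)" by (simp add: complex_subalgebra_def)
    from subringE[OF this] * show "matrix_subalgebra S'"
      by (simp add: matrix_subalgebra_def complex_subalgebra_def)
  next
    assume *: "matrix_subalgebra S'"
    have "subring S' (subalgebra_record S)"
      using assms(2) matrix_subalgebraD[OF *]
      by (intro R.subringI) (auto simp: a_inv_subalgebra_record[OF assms(1)] subset_iff)
    then show "complex_subalgebra S' (subalgebra_record S)"
      using matrix_subalgebraD(4)[OF *] by (simp add: complex_subalgebra_def)
  qed
qed

lemma generated_subalgebra_eq:
  fixes G :: "('d, 'n::finite) gmatrix set"
  shows "generated_subalgebra gmatrix_algebra G = matrix_subalgebra hull G"
proof -
  have U: "matrix_subalgebra (UNIV :: ('d, 'n) gmatrix set)" by (simp add: matrix_subalgebra_def)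
  have "subalgebra_record (UNIV :: ('d, 'n) gmatrix set) = gmatrix_algebra" by (simp add: gmatrix_algebra_def)
  note * = complex_subalgebra_subalgebra_record[OF U, unfolded this]
  have "complex_subalgebra S gmatrix_algebra \<longleftrightarrow> matrix_subalgebra S" for S :: "('d, 'n) gmatrix set"
    by (rule *) simp
  then show ?thesis by (simp add: generated_subalgebra_def)
qed

lemma generated_subalgebra_props:
  fixes G :: "('d, 'n::finite) gmatrix set"
  shows matrix_subalgebra_generated: "matrix_subalgebra (generated_subalgebra gmatrix_algebra G)"
    and generated_superset: "G \<subseteq> generated_subalgebra gmatrix_algebra G"
    and generated_minimal: "G \<subseteq> S \<Longrightarrow> matrix_subalgebra S \<Longrightarrow> generated_subalgebra gmatrix_algebra G \<subseteq> S"
proof -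
  have "matrix_subalgebra (\<Inter>\<S>)" if "\<forall>S\<in>\<S>. matrix_subalgebra S" for \<S> :: "('d, 'n) gmatrix set set"
    using that unfolding matrix_subalgebra_def by blast
  then show "matrix_subalgebra (generated_subalgebra gmatrix_algebra G)"
    unfolding generated_subalgebra_eq by (rule hull_in)
  show "G \<subseteq> generated_subalgebra gmatrix_algebra G"
    unfolding generated_subalgebra_eq by (rule hull_subset)
  show "G \<subseteq> S \<Longrightarrow> matrix_subalgebra S \<Longrightarrow> generated_subalgebra gmatrix_algebra G \<subseteq> S"
    unfolding generated_subalgebra_eq by (rule hull_minimal)
qed

section \<open>The trace ring as a finite module over the algebra of traces\<close>

definition trace_ring_set :: "('d, 'n::finite) gmatrix set"
  where "trace_ring_set = generated_subalgebra gmatrix_algebra (range generic_matrix \<union> range (\<lambda>w. tr (basis w)))"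

lemma trace_ring_eq: "trace_ring = subalgebra_record trace_ring_set"
  by (simp add: trace_ring_def trace_ring_set_def)

lemma tr_basis: "tr (basis w) = mat (trace (word_matrix w))"
  by (simp add: tr_def)

lemma matrix_subalgebra_trace_ring: "matrix_subalgebra trace_ring_set"
  unfolding trace_ring_set_def by (rule matrix_subalgebra_generated)

lemma matrix_subalgebra_trace_algebra: "matrix_subalgebra trace_algebra"
  unfolding trace_algebra_def by (rule matrix_subalgebra_generated)

lemma generic_in_trace_ring: "generic_matrix i \<in> trace_ring_set"
  and trace_in_trace_ring: "mat (trace (word_matrix w)) \<in> trace_ring_set"
  using generated_superset[of "range generic_matrix \<union> range (\<lambda>w. tr (basis w))"]
  unfolding trace_ring_set_def tr_basis by auto

lemma trace_in_trace_algebra: "mat (trace (word_matrix w)) \<in> trace_algebra"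
  using generated_superset[of "range (\<lambda>w. tr (basis w))"]
  unfolding trace_algebra_def tr_basis by auto

lemma trace_ring_induct:
  assumes "A \<in> trace_ring_set" "matrix_subalgebra {A. P A}" "\<And>i. P (generic_matrix i)"
    "\<And>w. P (mat (trace (word_matrix w)))"
  shows "P A"
  using generated_minimal[of "range generic_matrix \<union> range (\<lambda>w. tr (basis w))" "{A. P A}"] assms
  unfolding trace_ring_set_def tr_basis by auto

lemma trace_algebra_subset: "trace_algebra \<subseteq> trace_ring_set"
  unfolding trace_algebra_def
  by (rule generated_minimal[OF _ matrix_subalgebra_trace_ring]) (auto simp: tr_basis trace_in_trace_ring)

text \<open>The scalar matrices whose scalar satisfies \<open>P\<close> form a subalgebra containing
  the generators. Since \<open>P\<close> speaks of polynomials and the elements are matrices, the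
  scalar is delivered by an existential.\<close>

lemma trace_algebra_induct [consumes 1, case_names one trace add mult scale]:
  assumes "A \<in> trace_algebra" and "P 1" "\<And>w. P (trace (word_matrix w :: ('d, 'n::finite) gmatrix))"
    and "\<And>f g. P f \<Longrightarrow> P g \<Longrightarrow> P (f + g)" "\<And>f g. P f \<Longrightarrow> P g \<Longrightarrow> P (f * g)" "\<And>c f. P f \<Longrightarrow> P (cscale c f)"
  shows "\<exists>f. A = mat f \<and> P (f :: ('d, 'n) coord_ring)"
proof -
  have "matrix_subalgebra {mat f | f. P f}"
    unfolding matrix_subalgebra_def
  proof (intro conjI ballI allI)
    fix A B :: "('d, 'n) gmatrix" and c assume "A \<in> {mat f | f. P f}" "B \<in> {mat f | f. P f}"
    then show "A + B \<in> {mat f | f. P f}" "A ** B \<in> {mat f | f. P f}" "gmatrix_scale c A \<in> {mat f | f. P f}"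
      using assms(4-6) by (auto simp: mat_add[symmetric] mat_mult[symmetric] gmatrix_scale_simps(7))
  qed (use assms(2) in auto)
  then have "trace_algebra \<subseteq> {mat f | f. P f}"
    unfolding trace_algebra_def by (rule generated_minimal[rotated]) (use assms(3) in \<open>auto simp: tr_basis\<close>)
  with assms(1) show ?thesis by auto
qed

lemma trace_algebra_scalar:
  assumes "A \<in> trace_algebra"
  obtains f where "A = mat f"
proof -
  have "\<exists>f. A = mat f \<and> True" by (rule trace_algebra_induct[OF assms]) auto
  then show ?thesis using that by auto
qed

lemma trace_algebra_central: "A \<in> trace_algebra \<Longrightarrow> A ** B = B ** A"
  by (erule trace_algebra_scalar) (simp add: mat_central)

lemma word_matrix_in_trace_ring: "word_matrix w \<in> trace_ring_set"
  by (induction w) (auto intro: matrix_subalgebraD[OF matrix_subalgebra_trace_ring] generic_in_trace_ring)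

lemma eval_generic_in_trace_ring: "eval_generic a \<in> trace_ring_set"
  unfolding eval_generic_def
  by (intro matrix_subalgebra_sum matrix_subalgebra_trace_ring word_matrix_in_trace_ring
      matrix_subalgebraD(4)[OF matrix_subalgebra_trace_ring])

lemma tr_in_trace_algebra: "mat (trace (eval_generic a)) \<in> trace_algebra"
proof (induction a rule: basis_induct)
  case (basis k)
  then show ?case by (simp add: trace_in_trace_algebra)
next
  case (add p q)
  then show ?case by (auto simp: eval_generic_simps trace_add mat_add intro: matrix_subalgebraD[OF matrix_subalgebra_trace_algebra])
next
  case (scale c p)
  then show ?case
    using matrix_subalgebraD(4)[OF matrix_subalgebra_trace_algebra scale, of c]
    by (simp add: eval_generic_simps trace_gmatrix_scale gmatrix_scale_simps)
qed

lemma trace_product_in_trace_algebra: "trace_product e f \<Longrightarrow> mat f \<in> trace_algebra"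
  by (induction rule: trace_product.induct)
    (auto simp: mat_mult intro: matrix_subalgebraD[OF matrix_subalgebra_trace_algebra] trace_in_trace_algebra)

lemma matrix_subalgebra_trace_span: "matrix_subalgebra (trace_span (\<lambda>_ _. True) :: ('d::finite, 'n::finite) gmatrix set)"
  unfolding matrix_subalgebra_def
proof (intro conjI ballI allI)
  show "mat 1 \<in> (trace_span (\<lambda>_ _. True) :: ('d, 'n) gmatrix set)"
    using trace_span_base[OF trace_product.one, of "\<lambda>_ _. True" "[]"] by simp
  fix A B :: "('d, 'n) gmatrix" assume A: "A \<in> trace_span (\<lambda>_ _. True)" and B: "B \<in> trace_span (\<lambda>_ _. True)"
  show "A ** B \<in> trace_span (\<lambda>_ _. True)"
  proof (rule trace_span_map[OF A trace_span_subspace, of "\<lambda>A. A ** B"])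
    fix e and f :: "('d, 'n) coord_ring" and w :: "'d list" assume "trace_product e f"
    then show "mat f ** word_matrix w ** B \<in> trace_span (\<lambda>_ _. True)"
      unfolding matrix_mul_assoc[symmetric]
      by (rule trace_span_mat_mult[rotated]) (auto intro: trace_span_word_mult[OF B])
  qed (simp_all add: matrix_add_rdistrib gmatrix_scale_simps)
qed (auto intro: trace_span_add trace_span_scale)

lemma trace_ring_trace_span:
  "A \<in> trace_ring_set \<Longrightarrow> A \<in> (trace_span (\<lambda>_ _. True) :: ('d::finite, 'n::finite) gmatrix set)"
proof (erule trace_ring_induct)
  show "matrix_subalgebra {A. A \<in> (trace_span (\<lambda>_ _. True) :: ('d, 'n) gmatrix set)}"
    using matrix_subalgebra_trace_span by simp
  show "generic_matrix i \<in> (trace_span (\<lambda>_ _. True) :: ('d, 'n) gmatrix set)" for i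
    using trace_span_base[OF trace_product.one, of "\<lambda>_ _. True" "[i]"] by simp
  show "mat (trace (word_matrix w)) \<in> (trace_span (\<lambda>_ _. True) :: ('d, 'n) gmatrix set)" for w
  proof (cases "w = []")
    \<comment> \<open>The trace of the empty word is the constant n, reached by scaling
      \<open>mat 1\<close> and not as a trace product.\<close>
    case True
    then show ?thesis
      using matrix_subalgebraD(4)[OF matrix_subalgebra_trace_span matrix_subalgebraD(1)[OF matrix_subalgebra_trace_span], of "of_nat CARD('n)"]
      by (simp add: trace_mat gmatrix_scale_simps cscale_of_nat)
  next
    case False
    from trace_span_base[OF trace_product_trace[OF this], of "\<lambda>_ _. True" "[]"] show ?thesis by simp
  qed
qed

lemma trace_ring_finite:
  assumes "A \<in> trace_ring_set"
  defines "S \<equiv> word_matrix ` {w :: 'd::finite list. length w < 2 ^ CARD('n)} :: ('d, 'n::finite) gmatrix set"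
  shows "\<exists>c \<in> S \<rightarrow> trace_algebra. A = (\<Sum>s\<in>S. c s ** s)"
proof (rule trace_span_induct[OF trace_span_short[OF trace_ring_trace_span[OF assms(1)]]])
  note Z = matrix_subalgebraD[OF matrix_subalgebra_trace_algebra]
  have "finite {w :: 'd list. set w \<subseteq> UNIV \<and> length w \<le> 2 ^ CARD('n)}"
    by (rule finite_lists_length_le) simp
  then have fin: "finite S" unfolding S_def
    by (intro finite_imageI) (rule finite_subset[rotated], auto)
  let ?K = "{A. \<exists>c \<in> S \<rightarrow> trace_algebra. A = (\<Sum>s\<in>S. c s ** s)}"
  show "gvs.subspace ?K"
    unfolding gvs.subspace_def
  proof (intro conjI allI ballI)
    have "0 ** s = 0" for s :: "('d, 'n) gmatrix" by (simp add: vec_eq_iff matrix_matrix_mult_def)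
    then have "0 = (\<Sum>s\<in>S. 0 ** s)" by simp
    moreover have "(\<lambda>_. 0) \<in> S \<rightarrow> trace_algebra" using Z(5) by (rule Pi_I)
    ultimately show "0 \<in> ?K" by (intro CollectI bexI[of _ "\<lambda>_. 0"])
    fix A B c
    assume "A \<in> ?K" and "B \<in> ?K"
    then obtain a b where a: "a \<in> S \<rightarrow> trace_algebra" "A = (\<Sum>s\<in>S. a s ** s)"
      and b: "b \<in> S \<rightarrow> trace_algebra" "B = (\<Sum>s\<in>S. b s ** s)" by auto
    have "A + B = (\<Sum>s\<in>S. (a s + b s) ** s)"
      by (simp only: a(2) b(2) matrix_add_rdistrib sum.distrib)
    moreover have "(\<lambda>s. a s + b s) \<in> S \<rightarrow> trace_algebra"
      by (rule Pi_I, rule Z(2)) (rule Pi_mem[OF a(1)] Pi_mem[OF b(1)], assumption)+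
    ultimately show "A + B \<in> ?K" by (intro CollectI bexI[of _ "\<lambda>s. a s + b s"])
    have "gmatrix_scale c A = (\<Sum>s\<in>S. gmatrix_scale c (a s) ** s)"
      by (simp only: a(2) gmatrix_scale_simps gvs.scale_sum_right)
    moreover have "(\<lambda>s. gmatrix_scale c (a s)) \<in> S \<rightarrow> trace_algebra"
      by (rule Pi_I, rule Z(4)) (rule Pi_mem[OF a(1)])
    ultimately show "gmatrix_scale c A \<in> ?K" by (intro CollectI bexI[of _ "\<lambda>s. gmatrix_scale c (a s)"])
  qed
  fix e and f :: "('d, 'n) coord_ring" and w :: "'d list"
  assume f: "trace_product e f" and w: "length w < 2 ^ CARD('n)"
  \<comment> \<open>Coefficients are indexed by matrices, as different words can have the same
    matrix when n = 1.\<close>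
  let ?c = "\<lambda>s. if s = word_matrix w then mat f else 0"
  have z: "0 ** s = 0" for s :: "('d, 'n) gmatrix" by (simp add: vec_eq_iff matrix_matrix_mult_def)
  have "word_matrix w \<in> S" using w by (auto simp: S_def)
  have "(\<Sum>s\<in>S. ?c s ** s) = (\<Sum>s\<in>S. if s = word_matrix w then mat f ** s else 0)"
    by (rule sum.cong) (simp_all add: z)
  also have "\<dots> = mat f ** word_matrix w"
    using fin \<open>word_matrix w \<in> S\<close> by simp
  finally have "mat f ** word_matrix w = (\<Sum>s\<in>S. ?c s ** s)" by (rule sym)
  moreover have "?c \<in> S \<rightarrow> trace_algebra"
    by (rule Pi_I) (simp add: trace_product_in_trace_algebra[OF f] Z(5))
  ultimately show "\<exists>c \<in> S \<rightarrow> trace_algebra. mat f ** word_matrix w = (\<Sum>s\<in>S. c s ** s)"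
    by (rule bexI)
qed

text \<open>Closure under the trace is what later places scalar elements of the trace ring in the
  algebra of traces.\<close>

lemma trace_of_trace_ring:
  fixes A :: "('d::finite, 'n::finite) gmatrix"
  assumes "A \<in> trace_ring_set"
  shows "mat (trace A) \<in> (trace_algebra :: ('d, 'n) gmatrix set)"
proof (rule trace_span_map[OF trace_ring_trace_span[OF assms], of _ "\<lambda>A. mat (trace A)"])
  show "gvs.subspace (trace_algebra :: ('d, 'n) gmatrix set)"
    using matrix_subalgebraD[OF matrix_subalgebra_trace_algebra] unfolding gvs.subspace_def by blast
  show "mat (trace (mat f ** word_matrix w)) \<in> trace_algebra" if "trace_product e f" for e f w
    using matrix_subalgebraD(3)[OF matrix_subalgebra_trace_algebra trace_product_in_trace_algebra[OF that] trace_in_trace_algebra]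
    by (simp add: mat_mult)
qed (simp_all add: trace_add mat_add trace_gmatrix_scale gmatrix_scale_simps)

section \<open>The center\<close>

lemma lookup_var_mult:
  fixes p :: "('v \<Rightarrow>\<^sub>0 nat) \<Rightarrow>\<^sub>0 complex"
  shows "Poly_Mapping.lookup (basis (Poly_Mapping.single s 1) * p) (Poly_Mapping.single s 1 + x) = Poly_Mapping.lookup p x"
proof (induction p rule: basis_induct)
  case (basis k)
  show ?case by (simp add: basis_mult) (simp add: basis_def lookup_single when_def)
qed (simp_all add: distrib_left lookup_add)

lemma var_mult_cancel:
  fixes p :: "('v \<Rightarrow>\<^sub>0 nat) \<Rightarrow>\<^sub>0 complex"
  assumes "basis (Poly_Mapping.single s 1) * p = 0"
  shows "p = 0"
proof (rule poly_mapping_eqI)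
  fix x
  from lookup_var_mult[of s p x] assms show "Poly_Mapping.lookup p x = Poly_Mapping.lookup 0 x" by simp
qed

lemma keys_var_mult:
  fixes p :: "('v \<Rightarrow>\<^sub>0 nat) \<Rightarrow>\<^sub>0 complex"
  assumes "y \<in> Poly_Mapping.keys (basis (Poly_Mapping.single s 1) * p)"
  obtains x where "x \<in> Poly_Mapping.keys p" "y = Poly_Mapping.single s 1 + x"
  using assms keys_mult[of "basis (Poly_Mapping.single s 1)" p] by (auto simp: basis_def)

text \<open>A key of \<open>p\<close> of maximal \<open>s\<close>-degree gives a key of \<open>x\<^sub>s p\<close> that does not occur in \<open>x\<^sub>t p\<close>.\<close>

lemma var_diff_cancel:
  fixes p :: "('v \<Rightarrow>\<^sub>0 nat) \<Rightarrow>\<^sub>0 complex"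
  assumes "basis (Poly_Mapping.single s 1) * p = basis (Poly_Mapping.single t 1) * p" "s \<noteq> t"
  shows "p = 0"
proof (rule ccontr)
  assume "p \<noteq> 0"
  then have ne: "Poly_Mapping.keys p \<noteq> {}" by simp
  let ?D = "(\<lambda>x. Poly_Mapping.lookup x s) ` Poly_Mapping.keys p"
  have "Max ?D \<in> ?D" using ne by (intro Max_in) auto
  then obtain x where x: "x \<in> Poly_Mapping.keys p" "Poly_Mapping.lookup x s = Max ?D" by auto
  have "Poly_Mapping.single s 1 + x \<in> Poly_Mapping.keys (basis (Poly_Mapping.single t 1) * p)"
    unfolding assms(1)[symmetric] in_keys_iff lookup_var_mult using x(1) by (simp add: in_keys_iff)
  then obtain y where y: "y \<in> Poly_Mapping.keys p" "Poly_Mapping.single s 1 + x = Poly_Mapping.single t 1 + y"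
    by (rule keys_var_mult)
  from arg_cong[OF y(2), of "\<lambda>z. Poly_Mapping.lookup z s"] assms(2)
  have "Poly_Mapping.lookup y s = Suc (Poly_Mapping.lookup x s)" by (simp add: lookup_add lookup_single when_def)
  moreover have "Poly_Mapping.lookup y s \<le> Max ?D" using y(1) by (intro Max_ge) auto
  ultimately show False using x(2) by simp
qed

lemma component_mult_homogeneous:
  assumes "homogeneous \<omega> e f"
  shows "component \<omega> (m + e) (g * f) = component \<omega> m g * f"
proof (induction g rule: basis_induct)
  case (basis x)
  have "homogeneous \<omega> (weight \<omega> x + e) (basis x * f)"
    by (intro homogeneous_mult homogeneous_basis assms refl)
  moreover have "component \<omega> m (basis x) = (if weight \<omega> x = m then basis x else 0)"
    by (simp add: component_def)
  ultimately show ?case by (simp add: component_homogeneous)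
qed (simp_all add: distrib_right component_simps)

text \<open>
  Take the component of highest degree in the diagonal variables of \<open>X\<^sub>i\<close>: commutation with \<open>X\<^sub>i\<close> makes it
  diagonal, and commutation with \<open>X\<^sub>j\<close>, which has degree \<open>0\<close>, makes it scalar.
\<close>

lemma matrix_sub_rdistrib: "(A - B) ** C = A ** C - B ** C" for A B :: "'a::comm_ring_1^'n::finite^'m"
  by (simp add: vec_eq_iff matrix_matrix_mult_def left_diff_distrib sum_subtractf)

lemma commutant_scalar:
  fixes A :: "('d::finite, 'n::finite) gmatrix"
  assumes "i \<noteq> j" and Xi: "A ** generic_matrix i = generic_matrix i ** A"
    and Xj: "A ** generic_matrix j = generic_matrix j ** A"
  shows "A = mat (A $ k0 $ k0)"
proof (rule ccontr)
  \<comment> \<open>Subtracting a scalar matrix preserves the commutation relations and makes the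
    entry at \<open>k0\<close> vanish. A scalar top component of \<open>B\<close> is then zero,
    against the choice of the top degree.\<close>
  define B where "B = A - mat (A $ k0 $ k0)"
  assume "A \<noteq> mat (A $ k0 $ k0)"
  then have "B \<noteq> 0" by (simp add: B_def)
  have comm: "B ** Y = Y ** B" if "A ** Y = Y ** A" for Y
  proof -
    have "Y ** A - Y ** mat f = A ** Y - mat f ** Y" for f
      using that mat_central[of f Y] by simp
    then show ?thesis
      unfolding B_def by (simp add: matrix_sub_ldistrib matrix_sub_rdistrib)
  qed
  define \<omega> :: "'d \<times> 'n \<times> 'n \<Rightarrow> nat" where "\<omega> = (\<lambda>(h, k, l). if h = i \<and> k = l then 1 else 0)"
  define W where "W = (\<Union>k. \<Union>l. weight \<omega> ` Poly_Mapping.keys (B $ k $ l))"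
  have "finite W" by (simp add: W_def)
  obtain k1 l1 where "B $ k1 $ l1 \<noteq> 0" using \<open>B \<noteq> 0\<close> by (auto simp: vec_eq_iff)
  then have "Poly_Mapping.keys (B $ k1 $ l1) \<noteq> {}" by simp
  then have "W \<noteq> {}" by (auto simp: W_def)
  define m where "m = Max W"
  define C where "C k l = component \<omega> m (B $ k $ l)" for k l
  have top: "component \<omega> (Suc m) (B $ k $ l) = 0" for k l
  proof (rule poly_mapping_eqI)
    fix x
    have "weight \<omega> x \<noteq> Suc m" if "x \<in> Poly_Mapping.keys (B $ k $ l)"
    proof -
      have "weight \<omega> x \<in> W" using that by (auto simp: W_def)
      then have "weight \<omega> x \<le> m" unfolding m_def using \<open>finite W\<close> by (rule Max_ge[rotated])
      then show ?thesis by simp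
    qed
    then show "Poly_Mapping.lookup (component \<omega> (Suc m) (B $ k $ l)) x = Poly_Mapping.lookup 0 x"
      by (auto simp: lookup_component in_keys_iff)
  qed
  have hom: "homogeneous \<omega> (\<omega> (h, k, l)) (generic_matrix h $ k $ l)" for h k l
    unfolding generic_matrix_entry by (rule homogeneous_basis) (simp add: weight_single)
  have off: "C k l = 0" if "k \<noteq> l" for k l
  proof -
    let ?X = "generic_matrix i :: ('d, 'n) gmatrix"
    \<comment> \<open>In degree \<open>Suc m\<close> only top components times diagonal entries of
      X_i survive: off-diagonal entries have weight 0, and \<open>B\<close> has nothing in degree
      \<open>Suc m\<close>.\<close>
    have diag: "component \<omega> (Suc m) (g * ?X $ r $ s) = (if r = s then component \<omega> m g * ?X $ r $ s else 0)"
      if "component \<omega> (Suc m) g = 0" for g r s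
      using component_mult_homogeneous[OF hom[of i r s], of m g] component_mult_homogeneous[OF hom[of i r s], of "Suc m" g] that
      by (cases "r = s") (simp_all add: \<omega>_def)
    have "component \<omega> (Suc m) ((B ** ?X) $ k $ l) = C k l * ?X $ l $ l"
      by (simp add: matrix_matrix_mult_def component_sum diag top C_def cong: if_cong)
    moreover have "component \<omega> (Suc m) ((?X ** B) $ k $ l) = C k l * ?X $ k $ k"
      by (simp add: matrix_matrix_mult_def component_sum diag top C_def mult.commute[of "?X $ _ $ _"] cong: if_cong)
    ultimately have "?X $ l $ l * C k l = ?X $ k $ k * C k l" using comm[OF Xi] by (simp add: mult.commute)
    from var_diff_cancel[OF this[unfolded generic_matrix_entry]] that show ?thesis by simp
  qed
  have scal: "C k k = C l l" if "k \<noteq> l" for k l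
  proof -
    let ?Y = "generic_matrix j :: ('d, 'n) gmatrix"
    have Y: "component \<omega> m (g * ?Y $ r $ s) = component \<omega> m g * ?Y $ r $ s" for g r s
      using component_mult_homogeneous[OF hom[of j r s], of m g] \<open>i \<noteq> j\<close> by (simp add: \<omega>_def)
    have "component \<omega> m ((B ** ?Y) $ k $ l) = (\<Sum>r\<in>UNIV. C k r * ?Y $ r $ l)"
      by (simp add: matrix_matrix_mult_def component_sum Y C_def)
    also have "\<dots> = (\<Sum>r\<in>UNIV. if r = k then C k k * ?Y $ k $ l else 0)"
      by (rule sum.cong) (auto simp: off)
    finally have 1: "component \<omega> m ((B ** ?Y) $ k $ l) = C k k * ?Y $ k $ l" by simp
    have "component \<omega> m ((?Y ** B) $ k $ l) = (\<Sum>r\<in>UNIV. C r l * ?Y $ k $ r)"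
      by (simp add: matrix_matrix_mult_def component_sum Y C_def mult.commute[of "?Y $ _ $ _"])
    also have "\<dots> = (\<Sum>r\<in>UNIV. if r = l then C l l * ?Y $ k $ l else 0)"
      by (rule sum.cong) (auto simp: off)
    finally have 2: "component \<omega> m ((?Y ** B) $ k $ l) = C l l * ?Y $ k $ l" by simp
    \<comment> \<open>The off-diagonal entry of the commutation relation; a variable is not a zero
      divisor.\<close>
    from 1 2 comm[OF Xj] have "?Y $ k $ l * (C k k - C l l) = 0" by (simp add: algebra_simps)
    then have "C k k - C l l = 0" unfolding generic_matrix_entry by (rule var_mult_cancel)
    then show ?thesis by simp
  qed
  have "B $ k0 $ k0 = 0" by (simp add: B_def mat_def)
  then have "C k0 k0 = 0" by (simp add: C_def component_simps)
  then have C0: "C k l = 0" for k l using off[of k l] scal[of k k0] by (cases "k = l"; cases "k = k0") auto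
  have "m \<in> W" unfolding m_def using \<open>finite W\<close> \<open>W \<noteq> {}\<close> by (rule Max_in)
  then obtain k l x where x: "x \<in> Poly_Mapping.keys (B $ k $ l)" "weight \<omega> x = m" by (auto simp: W_def)
  have "Poly_Mapping.lookup (C k l) x \<noteq> 0" using x by (simp add: C_def lookup_component in_keys_iff)
  then show False by (simp add: C0)
qed

lemma center_trace_ring:
  fixes i j :: "'d::finite"
  assumes "i \<noteq> j"
  shows "algebra_center trace_ring = (trace_algebra :: ('d, 'n::finite) gmatrix set)"
proof
  note Z = matrix_subalgebraD[OF matrix_subalgebra_trace_algebra]
  show "trace_algebra \<subseteq> (algebra_center trace_ring :: ('d, 'n) gmatrix set)"
    using trace_algebra_subset trace_algebra_central by (auto simp: algebra_center_def trace_ring_eq)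
  show "algebra_center trace_ring \<subseteq> (trace_algebra :: ('d, 'n) gmatrix set)"
  proof
    fix A :: "('d, 'n) gmatrix" assume "A \<in> algebra_center trace_ring"
    then have A: "A \<in> trace_ring_set" "\<And>B. B \<in> trace_ring_set \<Longrightarrow> A ** B = B ** A"
      by (auto simp: algebra_center_def trace_ring_eq)
    define f where "f = A $ undefined $ undefined"
    have f: "A = mat f"
      unfolding f_def by (rule commutant_scalar[OF assms A(2) A(2)]; rule generic_in_trace_ring)
    \<comment> \<open>\<open>A\<close> is scalar, so its trace is n times the scalar; dividing by n
      stays in the algebra of traces.\<close>
    have "mat (trace A) \<in> (trace_algebra :: ('d, 'n) gmatrix set)" by (rule trace_of_trace_ring[OF A(1)])
    from Z(4)[OF this, of "inverse (of_nat CARD('n))"]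
    have "mat (cscale (inverse (of_nat CARD('n))) (cscale (of_nat CARD('n)) f)) \<in> (trace_algebra :: ('d, 'n) gmatrix set)"
      by (simp add: f trace_mat gmatrix_scale_simps cscale_of_nat del: cscale_cscale)
    then show "A \<in> trace_algebra" by (simp add: f)
  qed
qed

section \<open>The Poisson order\<close>

lemma finsum_subalgebra_record:
  assumes "matrix_subalgebra S" "finite I" "f \<in> I \<rightarrow> S"
  shows "finsum (subalgebra_record S) f I = sum f I"
proof -
  interpret R: ring "subalgebra_record S" by (rule ring_subalgebra_record[OF assms(1)])
  show ?thesis
    using assms(2,3)
  proof (induction I rule: finite_induct)
    case (insert x I)
    then show ?case by (subst R.finsum_insert) auto
  qed simp
qed

text \<open>Formulated for any central subalgebra above the algebra of traces, so that it serves
  both choices of \<open>Z\<close>. Finite generation over a larger \<open>Z\<close> is inherited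
  from \<open>trace_ring_finite\<close>.\<close>

lemma poisson_orderI:
  fixes Z :: "('d::finite, 'n::finite) gmatrix set"
  assumes Z: "matrix_subalgebra Z" "trace_algebra \<subseteq> Z" "Z \<subseteq> trace_ring_set"
    and central: "\<And>z A. z \<in> Z \<Longrightarrow> A \<in> trace_ring_set \<Longrightarrow> z ** A = A ** z"
    and HT: "\<And>z A. z \<in> Z \<Longrightarrow> A \<in> trace_ring_set \<Longrightarrow> H z A \<in> trace_ring_set"
    and HZ: "\<And>z z'. z \<in> Z \<Longrightarrow> z' \<in> Z \<Longrightarrow> H z z' \<in> Z"
    and Hr: "\<And>z A B. H z (A + B) = H z A + H z B" "\<And>z c A. H z (gmatrix_scale c A) = gmatrix_scale c (H z A)"
      "\<And>z A B. H z (A ** B) = A ** H z B + H z A ** B"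
    and Hl: "\<And>z z' A. H (z + z') A = H z A + H z' A" "\<And>z c A. H (gmatrix_scale c z) A = gmatrix_scale c (H z A)"
      "\<And>z z' A. z \<in> Z \<Longrightarrow> z' \<in> Z \<Longrightarrow> H (z ** z') A = z ** H z' A + z' ** H z A"
    and antisym: "\<And>z z'. z \<in> Z \<Longrightarrow> z' \<in> Z \<Longrightarrow> H z z' = - H z' z"
    and jacobi: "\<And>x y z. x \<in> Z \<Longrightarrow> y \<in> Z \<Longrightarrow> z \<in> Z \<Longrightarrow> H x (H y z) + H y (H z x) + H z (H x y) = 0"
  shows "poisson_order trace_ring Z H"
proof -
  have T: "matrix_subalgebra (trace_ring_set :: ('d, 'n) gmatrix set)" by (rule matrix_subalgebra_trace_ring)
  let ?T = "subalgebra_record (trace_ring_set :: ('d, 'n) gmatrix set)"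
  have fg: "finitely_generated_over ?T Z"
  proof -
    let ?S = "word_matrix ` {w :: 'd list. length w < 2 ^ CARD('n)} :: ('d, 'n) gmatrix set"
    have "finite {w :: 'd list. set w \<subseteq> UNIV \<and> length w \<le> 2 ^ CARD('n)}"
      by (rule finite_lists_length_le) simp
    then have fin: "finite ?S"
      by (intro finite_imageI) (rule finite_subset[rotated], auto)
    have sub: "?S \<subseteq> trace_ring_set" using word_matrix_in_trace_ring by auto
    have "\<exists>c\<in>?S \<rightarrow> Z. A = finsum ?T (\<lambda>s. c s \<otimes>\<^bsub>?T\<^esub> s) ?S" if "A \<in> trace_ring_set" for A
    proof -
      from trace_ring_finite[OF that]
      obtain c where c: "c \<in> ?S \<rightarrow> trace_algebra" "A = (\<Sum>s\<in>?S. c s ** s)"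
        by (rule bexE)
      have cZ: "c \<in> ?S \<rightarrow> Z" by (rule Pi_I) (rule subsetD[OF Z(2) Pi_mem[OF c(1)]])
      have "(\<lambda>s. c s ** s) \<in> ?S \<rightarrow> trace_ring_set"
        by (rule Pi_I, rule matrix_subalgebraD(3)[OF T])
          (rule subsetD[OF Z(3) Pi_mem[OF cZ]] subsetD[OF sub], assumption)+
      from finsum_subalgebra_record[OF T fin this] c(2) cZ show ?thesis
        by (intro bexI[of _ c]) simp_all
    qed
    then show ?thesis unfolding finitely_generated_over_def
      using fin sub by (intro exI[of _ ?S]) simp
  qed
  have der: "derivation ?T (H z)" if "z \<in> Z" for z
    unfolding derivation_def using HT[OF that] Hr by simp
  have poisson: "poisson_structure (subalgebra_record Z) H"
    unfolding poisson_structure_def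
  proof (intro conjI ballI)
    interpret R: ring "subalgebra_record Z" by (rule ring_subalgebra_record[OF Z(1)])
    show "complex_algebra (subalgebra_record Z)" by (rule complex_algebra_subalgebra_record[OF Z(1)])
    show "cring (subalgebra_record Z)"
    proof (rule cringI)
      show "abelian_group (subalgebra_record Z)" by (rule R.abelian_group_axioms)
      show "comm_monoid (subalgebra_record Z)"
        using central Z(3) by (intro R.monoid_comm_monoidI) (simp add: subset_iff)
    qed (simp add: matrix_add_rdistrib)
    fix x assume x: "x \<in> carrier (subalgebra_record Z)"
    show "derivation (subalgebra_record Z) (H x)"
      unfolding derivation_def using HZ x Hr by simp
    fix y assume y: "y \<in> carrier (subalgebra_record Z)"
    have "H y x \<in> Z" using HZ x y by simp
    from a_inv_subalgebra_record[OF Z(1) this]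
    show "H x y = \<ominus>\<^bsub>subalgebra_record Z\<^esub> H y x"
      using antisym[of x y] x y by simp
    fix z assume "z \<in> carrier (subalgebra_record Z)"
    then show "H x (H y z) \<oplus>\<^bsub>subalgebra_record Z\<^esub> H y (H z x) \<oplus>\<^bsub>subalgebra_record Z\<^esub> H z (H x y) =
      \<zero>\<^bsub>subalgebra_record Z\<^esub>"
      using jacobi[of x y z] x y by simp
  qed
  have "Z \<subseteq> algebra_center ?T"
    using Z(3) central by (auto simp: algebra_center_def)
  moreover have "complex_subalgebra Z ?T"
    using complex_subalgebra_subalgebra_record[OF T Z(3)] Z(1) by simp
  ultimately show ?thesis
    unfolding poisson_order_def trace_ring_eq
    using complex_algebra_subalgebra_record[OF T] fg poisson der Hl by simp
qed

lemma trace_function_induct [consumes 1, case_names one trace add mult scale]: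
  assumes "mat f \<in> (trace_algebra :: ('d::finite, 'n::finite) gmatrix set)"
    and "P 1" "\<And>w. P (trace (word_matrix w :: ('d, 'n) gmatrix))"
    and "\<And>f g. P f \<Longrightarrow> P g \<Longrightarrow> P (f + g)" "\<And>f g. P f \<Longrightarrow> P g \<Longrightarrow> P (f * g)" "\<And>c f. P f \<Longrightarrow> P (cscale c f)"
  shows "P f"
proof -
  have "\<exists>g. (mat f :: ('d, 'n) gmatrix) = mat g \<and> P g"
    using assms by (rule trace_algebra_induct)
  then show ?thesis by (auto simp: mat_eq_iff)
qed

section \<open>Derivations induced by traces\<close>

context double_bracket
begin

text \<open>On a scalar matrix \<open>z = f 1\<close> this is the entrywise bracket with \<open>f\<close>; on other \<open>z\<close> the value is irrelevant.\<close>

definition hamiltonian :: "('d, 'n::finite) gmatrix \<Rightarrow> ('d, 'n) gmatrix \<Rightarrow> ('d, 'n) gmatrix"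
  where "hamiltonian z A = (\<chi> u v. cb (z $ undefined $ undefined) (A $ u $ v))"

lemma hamiltonian_entry: "hamiltonian (mat f) A $ u $ v = cb f (A $ u $ v)"
  by (simp add: hamiltonian_def mat_def)

lemma hamiltonian_mat: "hamiltonian (mat f) (mat g) = mat (cb f g)"
  by (simp add: vec_eq_iff hamiltonian_entry) (simp add: mat_def coord_bracket_simps)

lemma hamiltonian_right:
  shows "hamiltonian z (A + B) = hamiltonian z A + hamiltonian z B"
    "hamiltonian z (gmatrix_scale c A) = gmatrix_scale c (hamiltonian z A)"
    "hamiltonian z (A ** B) = A ** hamiltonian z B + hamiltonian z A ** B"
  by (simp_all add: vec_eq_iff hamiltonian_def coord_bracket_simps)
    (simp add: matrix_matrix_mult_def coord_bracket_sum_right coord_bracket_mult_right sum.distrib)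

lemma hamiltonian_left:
  shows "hamiltonian (z + z') A = hamiltonian z A + hamiltonian z' A"
    "hamiltonian (gmatrix_scale c z) A = gmatrix_scale c (hamiltonian z A)"
    "hamiltonian (mat f ** mat g) A = mat f ** hamiltonian (mat g) A + mat g ** hamiltonian (mat f) A"
  by (simp_all add: vec_eq_iff hamiltonian_def coord_bracket_simps)
    (simp add: mat_def coord_bracket_mult_left)

lemma hamiltonian_trace_eval:
  "hamiltonian (mat (trace (eval_generic a))) (eval_generic b) = eval_generic (bracket_L D a b)"
  by (simp add: vec_eq_iff hamiltonian_entry trace_bracket)

lemma hamiltonian_trace_trace:
  "hamiltonian (mat (trace (word_matrix w))) (mat (trace (word_matrix w'))) =
    mat (trace (eval_generic (bracket_L D (basis w) (basis w'))))"
  by (simp add: hamiltonian_mat trace_trace_bracket[of "basis w" "basis w'", simplified])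

text \<open>The Leibniz rules in \<open>A\<close> and in \<open>f\<close> reduce the claim to
  brackets of word traces with generators, which are evaluated polynomials or traces by Van den
  Bergh's formula.\<close>

lemma hamiltonian_trace_ring:
  fixes f :: "('d, 'n::finite) coord_ring"
  assumes "mat f \<in> (trace_algebra :: ('d, 'n) gmatrix set)" "A \<in> (trace_ring_set :: ('d, 'n) gmatrix set)"
  shows "hamiltonian (mat f) A \<in> trace_ring_set"
proof -
  note T = matrix_subalgebraD[OF matrix_subalgebra_trace_ring]
  have one: "hamiltonian (mat f) (mat 1) = 0" for f :: "('d, 'n) coord_ring"
    by (simp add: hamiltonian_mat)
  have word: "hamiltonian (mat (trace (word_matrix w))) B \<in> (trace_ring_set :: ('d, 'n) gmatrix set)"
    if "B \<in> trace_ring_set" for w B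
  proof -
    let ?z = "mat (trace (word_matrix w)) :: ('d, 'n) gmatrix"
    \<comment> \<open>Leibniz terms multiply by the elements themselves, so membership of
      \<open>B\<close> is carried through the induction.\<close>
    have "B \<in> trace_ring_set \<and> hamiltonian ?z B \<in> trace_ring_set"
    proof (rule trace_ring_induct[OF that])
      show "matrix_subalgebra {B. B \<in> trace_ring_set \<and> hamiltonian ?z B \<in> trace_ring_set}"
        unfolding matrix_subalgebra_def by (auto simp: hamiltonian_right one intro: T)
      show "generic_matrix i \<in> trace_ring_set \<and> hamiltonian ?z (generic_matrix i) \<in> trace_ring_set" for i
        by (simp add: generic_in_trace_ring eval_generic_in_trace_ring
            hamiltonian_trace_eval[of "basis w" "basis [i]", simplified])
      show "mat (trace (word_matrix w')) \<in> trace_ring_set \<and> hamiltonian ?z (mat (trace (word_matrix w'))) \<in> trace_ring_set" for w'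
        using tr_in_trace_algebra trace_algebra_subset
        by (auto simp: hamiltonian_trace_trace trace_in_trace_ring)
    qed
    then show ?thesis by simp
  qed
  have "mat f \<in> trace_ring_set \<and> hamiltonian (mat f) A \<in> trace_ring_set"
    using assms(1)
  proof (induction rule: trace_function_induct)
    case one
    have "hamiltonian (mat 1) A = 0" by (simp add: vec_eq_iff hamiltonian_entry)
    then show ?case using T by simp
  next
    case (trace w)
    then show ?case using word[OF assms(2)] by (simp add: trace_in_trace_ring)
  next
    case (add f g)
    then show ?case by (simp add: mat_add hamiltonian_left T)
  next
    case (mult f g)
    then show ?case by (simp add: mat_mult hamiltonian_left T)
  next
    case (scale c f)
    then show ?case by (simp add: gmatrix_scale_simps(7)[symmetric] hamiltonian_left T)
  qed
  then show ?thesis by simp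
qed

lemma hamiltonian_trace_algebra:
  fixes f g :: "('d, 'n::finite) coord_ring"
  assumes "mat f \<in> (trace_algebra :: ('d, 'n) gmatrix set)" "mat g \<in> (trace_algebra :: ('d, 'n) gmatrix set)"
  shows "mat (cb f g) \<in> (trace_algebra :: ('d, 'n) gmatrix set)"
proof -
  let ?Z = "trace_algebra :: ('d, 'n) gmatrix set"
  note Z = matrix_subalgebraD[OF matrix_subalgebra_trace_algebra]
  have word: "mat (cb (trace (word_matrix w :: ('d, 'n) gmatrix)) g) \<in> ?Z" for w
  proof -
    have "mat g \<in> ?Z \<and> mat (cb (trace (word_matrix w :: ('d, 'n) gmatrix)) g) \<in> ?Z"
      using assms(2)
    proof (induction rule: trace_function_induct)
      case one
      then show ?case by (simp add: Z)
    next
      case (trace w')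
      then show ?case
        using trace_trace_bracket[of "basis w" "basis w'", where 'n = 'n]
        by (simp add: trace_in_trace_algebra tr_in_trace_algebra)
    next
      case (add f g)
      then show ?case by (simp add: coord_bracket_simps mat_add Z)
    next
      case (mult f g)
      then show ?case by (simp add: coord_bracket_mult_right mat_add mat_mult Z)
    next
      case (scale c f)
      then show ?case by (simp add: coord_bracket_simps gmatrix_scale_simps(7)[symmetric] Z)
    qed
    then show ?thesis by simp
  qed
  have "mat f \<in> ?Z \<and> mat (cb f g) \<in> ?Z"
    using assms(1)
  proof (induction rule: trace_function_induct)
    case one
    then show ?case by (simp add: Z)
  next
    case (trace w)
    then show ?case by (simp add: word trace_in_trace_algebra)
  next
    case (add f g)
    then show ?case by (simp add: coord_bracket_simps mat_add Z)
  next
    case (mult f g)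
    then show ?case by (simp add: coord_bracket_mult_left mat_add mat_mult Z)
  next
    case (scale c f)
    then show ?case by (simp add: coord_bracket_simps gmatrix_scale_simps(7)[symmetric] Z)
  qed
  then show ?thesis by simp
qed

section \<open>The Jacobi identity on the algebra of traces\<close>

definition jacobiator :: "('d, 'n::finite) coord_ring \<Rightarrow> ('d, 'n) coord_ring \<Rightarrow> ('d, 'n) coord_ring \<Rightarrow> ('d, 'n) coord_ring"
  where "jacobiator f g h = cb f (cb g h) + cb g (cb h f) + cb h (cb f g)"

lemma jacobiator_rotate: "jacobiator f g h = jacobiator g h f"
  by (simp add: jacobiator_def add_ac)

lemma jacobiator_simps:
  shows "jacobiator 1 g h = 0" "jacobiator (f + f') g h = jacobiator f g h + jacobiator f' g h"
    "jacobiator (cscale c f) g h = cscale c (jacobiator f g h)"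
  by (simp_all add: jacobiator_def coord_bracket_simps cscale_add)

text \<open>The jacobiator of an antisymmetric biderivation is itself a derivation in each argument:
  the cross terms, products of two single brackets, cancel by antisymmetry.\<close>

lemma jacobiator_mult: "jacobiator (f * f') g h = f * jacobiator f' g h + f' * jacobiator f g h"
proof -
  have a: "cb f g = - cb g f" "cb f' g = - cb g f'" "cb f h = - cb h f" "cb f' h = - cb h f'"
    by (rule cb_antisym)+
  show ?thesis
    unfolding jacobiator_def a
    by (simp add: coord_bracket_mult_left coord_bracket_mult_right coord_bracket_simps a algebra_simps)
qed

lemma jacobiator_extend:
  fixes g h :: "('d, 'n::finite) coord_ring"
  assumes "\<And>w. jacobiator (trace (word_matrix w :: ('d, 'n) gmatrix)) g h = 0"
    and "mat f \<in> (trace_algebra :: ('d, 'n) gmatrix set)"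
  shows "jacobiator f g h = 0"
  using assms(2)
  by (induction rule: trace_function_induct) (simp_all add: jacobiator_simps jacobiator_mult assms(1))

text \<open>The vanishing on word traces is extended one argument at a time, a rotation bringing the
  next argument to the front.\<close>

lemma jacobiator_trace_algebra:
  fixes f g h :: "('d, 'n::finite) coord_ring"
  assumes "mat f \<in> (trace_algebra :: ('d, 'n) gmatrix set)" "mat g \<in> (trace_algebra :: ('d, 'n) gmatrix set)"
    "mat h \<in> (trace_algebra :: ('d, 'n) gmatrix set)"
  shows "jacobiator f g h = 0"
proof -
  let ?t = "\<lambda>w. trace (word_matrix w :: ('d, 'n) gmatrix)"
  have 0: "jacobiator (?t u) (?t v) (?t w) = 0" for u v w
    using trace_jacobi[of "basis u" "basis v" "basis w", where 'n = 'n] by (simp add: jacobiator_def)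
  have 1: "jacobiator f (?t v) (?t w) = 0" for v w
    by (rule jacobiator_extend[OF 0 assms(1)])
  have 2: "jacobiator g (?t w) f = 0" for w
    by (rule jacobiator_extend[OF _ assms(2)]) (subst jacobiator_rotate[symmetric], rule 1)
  have "jacobiator h f g = 0"
    by (rule jacobiator_extend[OF _ assms(3)]) (subst jacobiator_rotate[symmetric], rule 2)
  then show ?thesis by (simp add: jacobiator_rotate[of h f g])
qed

lemma poisson_order_hamiltonian:
  "poisson_order trace_ring trace_algebra (hamiltonian :: ('d, 'n::finite) gmatrix \<Rightarrow> _)"
proof (rule poisson_orderI)
  fix x y z A :: "('d, 'n) gmatrix"
  assume x: "x \<in> trace_algebra"
  then obtain f where f: "x = mat f" by (rule trace_algebra_scalar)
  show "x ** A = A ** x" by (rule trace_algebra_central[OF x])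
  show "A \<in> trace_ring_set \<Longrightarrow> hamiltonian x A \<in> trace_ring_set"
    using hamiltonian_trace_ring x unfolding f by blast
  assume y: "y \<in> trace_algebra"
  then obtain g where g: "y = mat g" by (rule trace_algebra_scalar)
  show "hamiltonian x y \<in> trace_algebra"
    using hamiltonian_trace_algebra x y unfolding f g hamiltonian_mat by blast
  show "hamiltonian (x ** y) A = x ** hamiltonian y A + y ** hamiltonian x A"
    unfolding f g by (rule hamiltonian_left)
  show "hamiltonian x y = - hamiltonian y x"
    unfolding f g hamiltonian_mat by (subst cb_antisym) (simp add: vec_eq_iff mat_def)
  assume z: "z \<in> trace_algebra"
  then obtain h where h: "z = mat h" by (rule trace_algebra_scalar)
  show "hamiltonian x (hamiltonian y z) + hamiltonian y (hamiltonian z x) + hamiltonian z (hamiltonian x y) = 0"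
    using jacobiator_trace_algebra[of f g h] x y z
    unfolding f g h hamiltonian_mat mat_add[symmetric] jacobiator_def by simp
qed (rule matrix_subalgebra_trace_algebra trace_algebra_subset subset_refl hamiltonian_right hamiltonian_left)+

text \<open>For one generator the algebra is commutative, so \<open>mu\<close> kills the antisymmetric tensor \<open>D (x \<otimes> x)\<close>.\<close>

lemma bracket_L_one_generator:
  assumes "CARD('d) = 1"
  shows "bracket_L D a b = 0"
proof -
  have comm: "x @ y = y @ x" for x y :: "'d list"
  proof -
    obtain i :: 'd where "UNIV = {i}" using assms card_1_singletonE by blast
    then have "z = replicate (length z) i" for z :: "'d list"
      by (intro replicate_eqI) auto
    then show ?thesis by (metis replicate_add add.commute)
  qed
  have "mu (opposite t) = mu t" for t :: "'d free_alg2"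
    by (rule clinear_eq[OF clinear_compose[OF mu_linear opposite_linear] mu_linear])
      (auto simp: comm split: prod.split)
  then have anti: "bracket_L D a b = - bracket_L D b a" for a b
    unfolding bracket_L_def by (subst D_antisym) (simp add: mu_simps)
  \<comment> \<open>\<open>mu\<close> turns the outer action into multiplication, so
    \<open>bracket_L D a\<close> is a derivation of the free algebra and is determined by its values
    on letters.\<close>
  have letter: "bracket_L D a (basis v) = 0" if "\<And>i. bracket_L D a (basis [i]) = 0" for a v
  proof (induction v)
    case Nil
    then show ?case by (simp add: bracket_L_def basis_Nil mu_simps)
  next
    case (Cons i v)
    have mu1: "mu (outer (basis x) t 1) = basis x * mu t" for x t
      by (rule clinear_eq[OF clinear_compose[OF mu_linear outer_linear] mult_linear_left[OF mu_linear]])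
        (auto simp: basis_mult plus_list_def)
    have mu2: "mu (outer 1 t (basis x)) = mu t * basis x" for x t
      by (rule clinear_eq[OF clinear_compose[OF mu_linear outer_linear] mult_linear_right[OF mu_linear]])
        (auto simp: basis_mult plus_list_def)
    have "basis (i # v) = basis [i] * basis v" by (simp add: basis_mult plus_list_def)
    then show ?case
      using Cons that[of i] by (simp add: bracket_L_def D_leibniz mu_simps mu1 mu2)
  qed
  have "bracket_L D (basis [i]) (basis [j]) = 0" for i j
  proof -
    have "i = j" using assms by (metis card_1_singletonE UNIV_I singletonD)
    then have *: "bracket_L D (basis [i]) (basis [j]) = - bracket_L D (basis [i]) (basis [j])" using anti by metis
    show ?thesis
    proof (rule poly_mapping_eqI)
      fix k
      from arg_cong[OF *, of "\<lambda>p. Poly_Mapping.lookup p k"]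
      show "Poly_Mapping.lookup (bracket_L D (basis [i]) (basis [j])) k = Poly_Mapping.lookup 0 k" by simp
    qed
  qed
  then have "bracket_L D (basis [i]) (basis w) = 0" for i w by (rule letter)
  then have "bracket_L D (basis w) (basis [i]) = 0" for i w using anti[of "basis w" "basis [i]"] by simp
  then have words: "bracket_L D (basis w) (basis v) = 0" for w v by (rule letter)
  have "bracket_L D (basis w) b = 0" for w
    by (induction b rule: basis_induct)
      (simp_all add: words[unfolded bracket_L_def tensor_basis] bracket_L_def tensor_simps D_simps mu_simps)
  then show ?thesis
    by (induction a rule: basis_induct) (simp_all add: bracket_L_def tensor_simps D_simps mu_simps)
qed

end

text \<open>For one generator the center is not computed; it enters \<open>poisson_orderI\<close>
  just as a central subalgebra above the algebra of traces.\<close>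

lemma matrix_subalgebra_center:
  "matrix_subalgebra (algebra_center trace_ring :: ('d, 'n::finite) gmatrix set)"
  unfolding matrix_subalgebra_def
proof (intro conjI ballI allI)
  note T = matrix_subalgebraD[OF matrix_subalgebra_trace_ring]
  have center: "A \<in> algebra_center trace_ring \<longleftrightarrow>
      A \<in> trace_ring_set \<and> (\<forall>C\<in>trace_ring_set. A ** C = C ** A)" for A :: "('d, 'n) gmatrix"
    by (simp add: algebra_center_def trace_ring_eq)
  show "mat 1 \<in> (algebra_center trace_ring :: ('d, 'n) gmatrix set)"
    by (simp add: center T(1))
  fix A B :: "('d, 'n) gmatrix" and c
  assume A: "A \<in> algebra_center trace_ring"
  then show "gmatrix_scale c A \<in> algebra_center trace_ring"
    by (simp add: center T(4) gmatrix_scale_simps)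
  assume B: "B \<in> algebra_center trace_ring"
  with A show "A + B \<in> algebra_center trace_ring"
    by (simp add: center T(2) matrix_add_ldistrib matrix_add_rdistrib)
  have *: "(A ** B) ** C = C ** (A ** B)" if "C \<in> trace_ring_set" for C
  proof -
    have "A ** C = C ** A" "B ** C = C ** B" using A B that by (simp_all add: center)
    then show ?thesis by (metis matrix_mul_assoc)
  qed
  have "A ** B \<in> trace_ring_set" using A B unfolding center by (intro T(3)) (erule conjunct1)+
  then show "A ** B \<in> algebra_center trace_ring"
    unfolding center by (intro conjI ballI *)
qed

lemma poisson_order_zero:
  fixes Z :: "('d::finite, 'n::finite) gmatrix set"
  assumes "matrix_subalgebra Z" "trace_algebra \<subseteq> Z" "Z \<subseteq> algebra_center trace_ring"
  shows "poisson_order trace_ring Z (\<lambda>_ _. 0)"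
proof (rule poisson_orderI[OF assms(1,2)])
  show "Z \<subseteq> trace_ring_set" using assms(3) by (auto simp: algebra_center_def trace_ring_eq)
  show "z ** A = A ** z" if "z \<in> Z" "A \<in> trace_ring_set" for z A
    using that assms(3) by (auto simp: algebra_center_def trace_ring_eq)
qed (simp_all add: matrix_subalgebraD[OF matrix_subalgebra_trace_ring] matrix_subalgebraD[OF assms(1)]
    vec_eq_iff matrix_matrix_mult_def)

theorem corollary3:
  fixes D :: "'d::finite free_alg2 \<Rightarrow> 'd free_alg2"
  assumes "double_poisson_bracket D"
  shows "\<exists>H :: ('d, 'n::finite) gmatrix \<Rightarrow> ('d, 'n) gmatrix \<Rightarrow> ('d, 'n) gmatrix.
    (\<forall>w w'. H (tr (basis w)) (tr (basis w')) = tr (bracket_L D (basis w) (basis w'))) \<and>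
    (\<forall>w a. H (tr (basis w)) (eval_generic a) = eval_generic (bracket_L D (basis w) a)) \<and>
    poisson_order trace_ring trace_algebra H \<and>
    poisson_order trace_ring (algebra_center trace_ring) H"
proof -
  interpret double_bracket D by unfold_locales (rule assms)
  show ?thesis
  proof (cases "CARD('d) = 1")
    case True
    have center: "trace_algebra \<subseteq> (algebra_center trace_ring :: ('d, 'n) gmatrix set)"
      using trace_algebra_subset trace_algebra_central by (auto simp: algebra_center_def trace_ring_eq)
    have "tr 0 = (0 :: ('d, 'n) gmatrix)" by (simp add: tr_def eval_generic_simps trace_0[simplified])
    \<comment> \<open>All brackets \<open>bracket_L D a b\<close> vanish, so the zero map takes the
      prescribed values and works over both subalgebras at once.\<close>
    then show ?thesis
      using poisson_order_zero[OF matrix_subalgebra_trace_algebra subset_refl center]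
        poisson_order_zero[OF matrix_subalgebra_center center subset_refl]
      by (intro exI[of _ "\<lambda>_ _. 0"]) (simp add: bracket_L_one_generator[OF True] eval_generic_simps)
  next
    case False
    have "\<exists>i j :: 'd. i \<noteq> j"
    proof (rule ccontr)
      assume "\<not> ?thesis"
      then have "UNIV = {undefined :: 'd}" by auto
      from arg_cong[OF this, of card] False show False by simp
    qed
    then obtain i j :: 'd where "i \<noteq> j" by blast
    have "poisson_order trace_ring (algebra_center trace_ring) (hamiltonian :: ('d, 'n) gmatrix \<Rightarrow> _)"
      unfolding center_trace_ring[OF \<open>i \<noteq> j\<close>] by (rule poisson_order_hamiltonian)
    moreover have "\<forall>w a. hamiltonian (tr (basis w)) (eval_generic a) = (eval_generic (bracket_L D (basis w) a) :: ('d, 'n) gmatrix)"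
      by (simp add: tr_def hamiltonian_trace_eval[symmetric])
    moreover have "\<forall>w w'. hamiltonian (tr (basis w)) (tr (basis w')) = (tr (bracket_L D (basis w) (basis w')) :: ('d, 'n) gmatrix)"
      unfolding tr_basis hamiltonian_trace_trace by (simp add: tr_def)
    ultimately show ?thesis
      using poisson_order_hamiltonian by (intro exI[of _ hamiltonian] conjI)
  qed
qed

end
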